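(* For each $i\ge1$ let $u_i:Prim({\cal H}_R)^{\otimes i}\to Prim({\cal H}_R)$ be a linear map, and let $\Phi_{(u_i)}:{\cal H}_R\to{\cal H}_R$ be the linear map defined by $\Phi_{(u_i)}(1)=1$ and, for $n\ge1$ and primitive $p_1,\dots,p_n$, $$\Phi_{(u_i)}(p_n\top\cdots\top p_1)=\sum_{k=1}^{n}\ \sum_{\substack{a_1+\cdots+a_k=n\\ a_r\ge1}}\big(\overline{u_{a_1}\otimes\cdots\otimes u_{a_k}}\big)(p_n\top\cdots\top p_1).$$ Then $\Phi_{(u_i)}$ is a coalgebra endomorphism of $({\cal H}_R,\Delta,\varepsilon)$. Conversely, if $\Phi$ is a coalgebra endomorphism of $({\cal H}_R,\Delta,\varepsilon)$, then there exists a unique family of linear maps $u_i:Prim({\cal H}_R)^{\otimes i}\to Prim({\cal H}_R)$, $i\ge1$, such that $\Phi=\Phi_{(u_i)}$.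
   Context: ${\cal H}_R$ is the commutative polynomial algebra over $\mathbb{Q}$ on isomorphism classes of rooted trees (finite connected simply connected graphs with a root, edges oriented away from the root; weight = number of vertices), a Hopf algebra with coproduct the algebra morphism $\Delta(t)=1\otimes t+t\otimes1+\sum_CP^C(t)\otimes R^C(t)$ over admissible cuts $C$ (nonempty edge sets meeting each root-to-vertex path at most once; $R^C(t)$ = component containing the root, $P^C(t)$ = product of the others) and counit $\varepsilon$. $Prim({\cal H}_R)$ = primitive elements. For forests $M,N$: $M\top N=0$ if $N=1$, else $\frac{1}{weight(N)}\sum_vN_v$, $v$ over vertices of $N$, $N_v$ obtained by attaching every tree of $M$ to $v$; bilinear extension. $F_i:Prim({\cal H}_R)^{\otimes i}\to{\cal H}_R$, $p_i\otimes\cdots\otimes p_1\mapsto p_i\top\cdots\top p_1:=(\cdots(p_i\top p_{i-1})\cdots)\top p_1$. Each $F_i$ is injective and ${\cal H}_R=\mathbb{Q}1\oplus\bigoplus_{i\ge1}Im(F_i)$. For a linear map $u:Prim({\cal H}_R)^{\otimes i}\to Prim({\cal H}_R)^{\otimes j}$, $\overline u:=F_j\circ u\circ F_i^{-1}:Im(F_i)\to Im(F_j)$. In the formula, $u_{a_1}\otimes\cdots\otimes u_{a_k}$ acts on $Prim^{\otimes n}=Prim^{\otimes a_1}\otimes\cdots\otimes Prim^{\otimes a_k}$ (tensor factors ordered $p_n,\dots,p_1$). (The associated graded Hopf algebra $gr({\cal H}_R)$ for the filtration by $\mathbb{Q}1\oplus\bigoplus_{j\le n}Im(F_j)$ has the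 same underlying coalgebra.) *)

theory Defs
  imports Complex_Main "HOL-Library.Multiset" "HOL-Library.Poly_Mapping" "HOL-Library.Product_Plus"
begin

text \<open>An isomorphism class of rooted trees is a root together with the multiset of
  (isomorphism classes of) subtrees hanging from the children of the root.\<close>
datatype tree = Node "tree multiset"

type_synonym forest = "tree multiset"

primrec tweight :: "tree \<Rightarrow> nat" where
  "tweight (Node cs) = Suc (sum_mset (image_mset tweight cs))"

definition fweight :: "forest \<Rightarrow> nat" where
  "fweight N = sum_mset (image_mset tweight N)"

text \<open>Planar representatives, used to address vertices and edges concretely.
  A vertex is addressed by the list of child indices on the path from the root;
  the edge into a non-root vertex is identified with the address of that vertex.\<close>
datatype ptree = PNode "ptree list"

primrec to_tree :: "ptree \<Rightarrow> tree" where
  "to_tree (PNode ts) = Node (mset (map to_tree ts))"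

fun valid_addr :: "ptree \<Rightarrow> nat list \<Rightarrow> bool" where
  "valid_addr (PNode ts) [] = True"
| "valid_addr (PNode ts) (i # a) = (i < length ts \<and> valid_addr (ts ! i) a)"

fun subt :: "ptree \<Rightarrow> nat list \<Rightarrow> ptree" where
  "subt t [] = t"
| "subt (PNode ts) (i # a) = subt (ts ! i) a"

primrec prune :: "ptree \<Rightarrow> nat list set \<Rightarrow> ptree" where
  "prune (PNode ts) = (\<lambda>C. PNode (map (\<lambda>(i, f). f {a. i # a \<in> C})
       (filter (\<lambda>(i, f). [i] \<notin> C) (zip [0..<length ts] (map prune ts)))))"

text \<open>Admissible cuts: nonempty sets of edges meeting each root-to-vertex path at
  most once (i.e. no edge lies above another one).\<close>
definition adm_cuts :: "ptree \<Rightarrow> nat list set set" where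
  "adm_cuts p = {C. C \<noteq> {} \<and> C \<subseteq> {a. a \<noteq> [] \<and> valid_addr p a}
      \<and> (\<forall>a\<in>C. \<forall>b\<in>C. (\<exists>c. b = a @ c) \<longrightarrow> a = b)}"

definition cut_P :: "ptree \<Rightarrow> nat list set \<Rightarrow> forest" where
  "cut_P p C = image_mset (\<lambda>a. to_tree (subt p a)) (mset_set C)"

definition cut_R :: "ptree \<Rightarrow> nat list set \<Rightarrow> tree" where
  "cut_R p C = to_tree (prune p C)"

text \<open>\<open>H_R\<close>: the polynomial algebra on trees, i.e. finitely supported functions on
  monomials (forests); the product is convolution (union of forests), the unit is the
  empty forest.\<close>
type_synonym H = "forest \<Rightarrow>\<^sub>0 rat"

text \<open>\<open>H \<otimes> H\<close> with basis pairs of forests (an algebra, componentwise).\<close>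
type_synonym H2 = "(forest \<times> forest) \<Rightarrow>\<^sub>0 rat"

text \<open>Tensor powers: \<open>H^{\<otimes> i}\<close> is the part of \<open>T\<close> supported on lists of length \<open>i\<close>;
  the list \<open>[x_n, \<dots>, x_1]\<close> stands for \<open>x_n \<otimes> \<dots> \<otimes> x_1\<close>.\<close>
type_synonym T = "forest list \<Rightarrow>\<^sub>0 rat"

definition sc :: "rat \<Rightarrow> ('a \<Rightarrow>\<^sub>0 rat) \<Rightarrow> ('a \<Rightarrow>\<^sub>0 rat)" where
  "sc c x = Poly_Mapping.map (\<lambda>v. c * v) x"

definition qlinear :: "(('a \<Rightarrow>\<^sub>0 rat) \<Rightarrow> ('b \<Rightarrow>\<^sub>0 rat)) \<Rightarrow> bool" where
  "qlinear f \<longleftrightarrow> (\<forall>x y. f (x + y) = f x + f y) \<and> (\<forall>c x. f (sc c x) = sc c (f x))"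

definition tensor2 :: "H \<Rightarrow> H \<Rightarrow> H2" where
  "tensor2 h k = (\<Sum>a\<in>Poly_Mapping.keys h. \<Sum>b\<in>Poly_Mapping.keys k.
       Poly_Mapping.single (a, b) (Poly_Mapping.lookup h a * Poly_Mapping.lookup k b))"

definition tmap2 :: "(H \<Rightarrow> H) \<Rightarrow> (H \<Rightarrow> H) \<Rightarrow> H2 \<Rightarrow> H2" where
  "tmap2 f g z = (\<Sum>ab\<in>Poly_Mapping.keys z. sc (Poly_Mapping.lookup z ab)
       (tensor2 (f (Poly_Mapping.single (fst ab) 1)) (g (Poly_Mapping.single (snd ab) 1))))"

definition Delta_tree :: "tree \<Rightarrow> H2" where
  "Delta_tree t = (let p = (SOME p. to_tree p = t) in
      Poly_Mapping.single ({#}, {#t#}) 1 + Poly_Mapping.single ({#t#}, {#}) 1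
      + (\<Sum>C\<in>adm_cuts p. Poly_Mapping.single (cut_P p C, {#cut_R p C#}) 1))"

definition Delta_forest :: "forest \<Rightarrow> H2" where
  "Delta_forest F = prod_mset (image_mset Delta_tree F)"

definition Delta :: "H \<Rightarrow> H2" where
  "Delta x = (\<Sum>F\<in>Poly_Mapping.keys x. sc (Poly_Mapping.lookup x F) (Delta_forest F))"

definition eps :: "H \<Rightarrow> rat" where
  "eps x = Poly_Mapping.lookup x {#}"

definition Prim :: "H set" where
  "Prim = {p. Delta p = tensor2 p 1 + tensor2 1 p}"

definition coalg_endo :: "(H \<Rightarrow> H) \<Rightarrow> bool" where
  "coalg_endo \<Phi> \<longleftrightarrow> qlinear \<Phi> \<and> (\<forall>x. eps (\<Phi> x) = eps x)
      \<and> (\<forall>x. Delta (\<Phi> x) = tmap2 \<Phi> \<Phi> (Delta x))"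

text \<open>\<open>graft t M\<close>: the multiset, indexed by the vertices \<open>v\<close> of \<open>t\<close>, of the trees
  obtained by attaching every tree of \<open>M\<close> to \<open>v\<close>.\<close>
primrec graft :: "tree \<Rightarrow> forest \<Rightarrow> tree multiset" where
  "graft (Node cs) = (\<lambda>M. add_mset (Node (cs + M))
      (sum_mset (image_mset (\<lambda>(c, g). image_mset (\<lambda>c'. Node (add_mset c' (cs - {#c#}))) (g M))
          (image_mset (\<lambda>c. (c, graft c)) cs))))"

definition graftF :: "forest \<Rightarrow> forest \<Rightarrow> forest multiset" where
  "graftF M N = sum_mset (image_mset (\<lambda>t. image_mset (\<lambda>t'. add_mset t' (N - {#t#})) (graft t M)) N)"

definition topF :: "forest \<Rightarrow> forest \<Rightarrow> H" where
  "topF M N = (if N = {#} then 0 else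
      sc (1 / of_nat (fweight N)) (sum_mset (image_mset (\<lambda>F. Poly_Mapping.single F 1) (graftF M N))))"

definition top :: "H \<Rightarrow> H \<Rightarrow> H" where
  "top x y = (\<Sum>M\<in>Poly_Mapping.keys x. \<Sum>N\<in>Poly_Mapping.keys y.
       sc (Poly_Mapping.lookup x M * Poly_Mapping.lookup y N) (topF M N))"

fun Fl :: "forest list \<Rightarrow> H" where
  "Fl [] = 1"
| "Fl (x # xs) = foldl (\<lambda>acc y. top acc (Poly_Mapping.single y 1)) (Poly_Mapping.single x 1) xs"

definition Fmap :: "T \<Rightarrow> H" where
  "Fmap x = (\<Sum>l\<in>Poly_Mapping.keys x. sc (Poly_Mapping.lookup x l) (Fl l))"

definition tensT :: "T \<Rightarrow> T \<Rightarrow> T" where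
  "tensT a b = (\<Sum>l\<in>Poly_Mapping.keys a. \<Sum>m\<in>Poly_Mapping.keys b.
       Poly_Mapping.single (l @ m) (Poly_Mapping.lookup a l * Poly_Mapping.lookup b m))"

definition lift :: "H \<Rightarrow> T" where
  "lift h = (\<Sum>f\<in>Poly_Mapping.keys h. Poly_Mapping.single [f] (Poly_Mapping.lookup h f))"

primrec ptens :: "H list \<Rightarrow> T" where
  "ptens [] = Poly_Mapping.single [] 1"
| "ptens (h # hs) = tensT (lift h) (ptens hs)"

inductive_set qspan :: "('a \<Rightarrow>\<^sub>0 rat) set \<Rightarrow> ('a \<Rightarrow>\<^sub>0 rat) set" for S where
  zero: "0 \<in> qspan S"
| add: "s \<in> S \<Longrightarrow> y \<in> qspan S \<Longrightarrow> sc c s + y \<in> qspan S"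

definition Prim_tens :: "nat \<Rightarrow> T set" where
  "Prim_tens i = qspan {ptens ps | ps. length ps = i \<and> set ps \<subseteq> Prim}"

primrec blocks :: "(nat \<Rightarrow> T \<Rightarrow> H) \<Rightarrow> nat list \<Rightarrow> forest list \<Rightarrow> T" where
  "blocks u [] l = Poly_Mapping.single [] 1"
| "blocks u (a # as) l = tensT (lift (u a (Poly_Mapping.single (take a l) 1))) (blocks u as (drop a l))"

definition tmaps :: "(nat \<Rightarrow> T \<Rightarrow> H) \<Rightarrow> nat list \<Rightarrow> T \<Rightarrow> T" where
  "tmaps u as x = (\<Sum>l\<in>Poly_Mapping.keys x. sc (Poly_Mapping.lookup x l) (blocks u as l))"

definition compositions :: "nat \<Rightarrow> nat \<Rightarrow> nat list set" where
  "compositions n k = {as. length as = k \<and> (\<forall>a\<in>set as. 1 \<le> a) \<and> sum_list as = n}"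

text \<open>A family \<open>u_i : Prim^{\<otimes> i} \<rightarrow> Prim\<close> (\<open>i \<ge> 1\<close>) of linear maps, represented by
  linear maps on \<open>T\<close> (every linear map on the subspace extends); only the
  restrictions to \<open>Prim^{\<otimes> i}\<close> matter.\<close>
definition valid_family :: "(nat \<Rightarrow> T \<Rightarrow> H) \<Rightarrow> bool" where
  "valid_family u \<longleftrightarrow> (\<forall>i\<ge>1. qlinear (u i) \<and> (\<forall>x\<in>Prim_tens i. u i x \<in> Prim))"

definition is_Phi_of :: "(nat \<Rightarrow> T \<Rightarrow> H) \<Rightarrow> (H \<Rightarrow> H) \<Rightarrow> bool" where
  "is_Phi_of u \<Phi> \<longleftrightarrow> qlinear \<Phi> \<and> \<Phi> 1 = 1 \<and>
     (\<forall>n\<ge>1. \<forall>x\<in>Prim_tens n.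
        \<Phi> (Fmap x) = (\<Sum>k\<in>{1..n}. \<Sum>as\<in>compositions n k. Fmap (tmaps u as x)))"

definition Phi_of :: "(nat \<Rightarrow> T \<Rightarrow> H) \<Rightarrow> H \<Rightarrow> H" where
  "Phi_of u = (THE \<Phi>. is_Phi_of u \<Phi>)"

end

theory Submission
  imports Defs
begin

text \<open>
Choose a basis \<open>B\<close> of the primitive elements and let \<open>F w\<close> be the iterated grafting of a
  word \<open>w\<close> over \<open>B\<close>.  Grafting onto vertices is a derivation in its second argument, and
  for primitive \<open>p\<close> this gives
  \<open>\<Delta> (x \<top> p) = (x \<top> p) \<otimes> 1 + (id \<otimes> (_ \<top> p)) (\<Delta> x)\<close>.  So the
  coproduct of \<open>F w\<close> is deconcatenation, and the elements \<open>F w\<close> form a basis: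
  independence by splitting off the last letter, generation by induction on the weight
  with the help of coassociativity.  The coalgebra is therefore the cofree one on the
  primitive elements.  An endomorphism \<open>\<Phi>\<close> is determined by \<open>\<pi> \<circ> \<Phi>\<close>, where \<open>\<pi>\<close> projects
  onto the words of length one, because the difference of two endomorphisms that agree on
  shorter words maps a word to a primitive element; and \<open>\<pi> \<circ> \<Phi>\<close> on words of length \<open>i\<close>
  is exactly the map \<open>u\<^sub>i\<close>.
\<close>

subsection \<open>Linear maps between spaces of finitely supported functions\<close>

text \<open>Cuts of a planar representative do not lend themselves to algebra. The coproduct is
  therefore first turned into the recursion \<Delta> (B x) = B x \<otimes> 1 + (id \<otimes> B)
  (\<Delta> x), where B (\<open>bplus\<close>) puts a forest under a new root. Identities on forests
  then follow by induction over the empty forest, products and B. The factor 1 / weight in \<top>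
  makes 1 \<top> p = p, so that words can be built by appending letters to the empty word. It is
  split off as the map \<open>wdiv\<close>, because only the unnormalised grafting \<open>gr\<close>
  is a derivation; \<open>wdiv\<close> preserves primitive elements since the coproduct is graded.
  Generation by words has to be proved while only a left inverse of the map from words to H is at
  hand. The value of an endomorphism at 1 is not part of its definition either; it comes from the
  fact that 1 is the only group-like element of counit 1.\<close>

abbreviation bas :: "'a \<Rightarrow> 'a \<Rightarrow>\<^sub>0 rat" where
  "bas k \<equiv> Poly_Mapping.single k 1"

abbreviation coef :: "('a \<Rightarrow>\<^sub>0 rat) \<Rightarrow> 'a \<Rightarrow> rat" where
  "coef \<equiv> Poly_Mapping.lookup"

lemma lookup_sc [simp]: "coef (sc c x) k = c * coef x k"
  unfolding sc_def by (simp add: Poly_Mapping.map.rep_eq when_def)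

lemma vector_space_sc: "vector_space (sc :: rat \<Rightarrow> ('a \<Rightarrow>\<^sub>0 rat) \<Rightarrow> _)"
  by unfold_locales (rule poly_mapping_eqI; simp add: lookup_add algebra_simps)+

interpretation pm: vector_space "sc :: rat \<Rightarrow> ('a \<Rightarrow>\<^sub>0 rat) \<Rightarrow> _"
  by (rule vector_space_sc)

interpretation pmp: vector_space_pair "sc :: rat \<Rightarrow> ('a \<Rightarrow>\<^sub>0 rat) \<Rightarrow> _" "sc :: rat \<Rightarrow> ('b \<Rightarrow>\<^sub>0 rat) \<Rightarrow> _"
  by unfold_locales

lemma sc_single: "sc c (Poly_Mapping.single k d) = Poly_Mapping.single k (c * d)"
  by (rule poly_mapping_eqI) (simp add: lookup_single when_def)

lemma single_eq_sc_bas: "Poly_Mapping.single k c = sc c (bas k)"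
  by (simp add: sc_single)

lemma poly_mapping_eq_sum_bas: "x = (\<Sum>k\<in>Poly_Mapping.keys x. sc (coef x k) (bas k))"
  by (rule poly_mapping_eqI)
    (simp add: lookup_sum lookup_single when_def sum.delta if_distrib in_keys_iff cong: if_cong)

lemma qlinear_iff_linear: "qlinear f \<longleftrightarrow> Vector_Spaces.linear sc sc f"
  by (auto simp: qlinear_def Vector_Spaces.linear_iff vector_space_sc)

lemma qlinearI:
  assumes "\<And>x y. f (x + y) = f x + f y" and "\<And>c x. f (sc c x) = sc c (f x)"
  shows "qlinear f"
  using assms by (simp add: qlinear_def)

lemma qlinear_add: "qlinear f \<Longrightarrow> f (x + y) = f x + f y"
  and qlinear_sc: "qlinear f \<Longrightarrow> f (sc c x) = sc c (f x)"
  by (simp_all add: qlinear_def)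

lemma qlinear_0: "qlinear f \<Longrightarrow> f 0 = 0"
  using qlinear_sc[of f 0 0] by simp

lemma qlinear_diff: "qlinear f \<Longrightarrow> f (x - y) = f x - f y"
  by (metis add_diff_cancel diff_add_cancel qlinear_add)

lemma qlinear_sum: "qlinear f \<Longrightarrow> f (\<Sum>i\<in>I. g i) = (\<Sum>i\<in>I. f (g i))"
  by (induction I rule: infinite_finite_induct) (simp_all add: qlinear_0 qlinear_add)

lemma qlinear_sum_mset: "qlinear f \<Longrightarrow> f (sum_mset X) = sum_mset (image_mset f X)"
  by (induction X) (simp_all add: qlinear_0 qlinear_add)

named_theorems qlin

lemma qlinear_ident [qlin]: "qlinear (\<lambda>x. x)"
  by (simp add: qlinear_def)

lemma qlinear_zero [qlin]: "qlinear (\<lambda>x. 0)"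
  by (simp add: qlinear_def)

lemma qlinear_plus [qlin]: "qlinear f \<Longrightarrow> qlinear g \<Longrightarrow> qlinear (\<lambda>x. f x + g x)"
  by (simp add: qlinear_def pm.scale_right_distrib)

lemma qlinear_minus [qlin]: "qlinear f \<Longrightarrow> qlinear g \<Longrightarrow> qlinear (\<lambda>x. f x - g x)"
  by (simp add: qlinear_def pm.scale_right_diff_distrib)

lemma qlinear_scale [qlin]: "qlinear f \<Longrightarrow> qlinear (\<lambda>x. sc c (f x))"
  by (simp add: qlinear_def pm.scale_right_distrib mult.commute)

lemma qlinear_setsum [qlin]: "(\<And>i. i \<in> I \<Longrightarrow> qlinear (f i)) \<Longrightarrow> qlinear (\<lambda>x. \<Sum>i\<in>I. f i x)"
  by (induction I rule: infinite_finite_induct) (simp_all add: qlin)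

lemma qlinear_compose: "qlinear f \<Longrightarrow> qlinear g \<Longrightarrow> qlinear (\<lambda>x. f (g x))"
  by (simp add: qlinear_def)

text \<open>Agreement is asked on the support of \<open>x\<close> only: many identities below hold
  just for words over primitive letters, or for lists of one length.\<close>

lemma qlinear_ext_on:
  assumes "qlinear f" "qlinear g" "\<And>k. k \<in> Poly_Mapping.keys x \<Longrightarrow> f (bas k) = g (bas k)"
  shows "f x = g x"
proof -
  have *: "h x = (\<Sum>k\<in>Poly_Mapping.keys x. sc (coef x k) (h (bas k)))"
    if "qlinear h" for h :: "_ \<Rightarrow> 'b \<Rightarrow>\<^sub>0 rat"
  proof -
    have "h x = h (\<Sum>k\<in>Poly_Mapping.keys x. sc (coef x k) (bas k))"
      by (rule arg_cong[OF poly_mapping_eq_sum_bas])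
    then show ?thesis by (simp add: qlinear_sum[OF that] qlinear_sc[OF that])
  qed
  show ?thesis
    unfolding *[OF assms(1)] *[OF assms(2)] by (intro sum.cong refl) (simp add: assms(3))
qed

lemma qlinear_ext:
  assumes "qlinear f" "qlinear g" "\<And>k. f (bas k) = g (bas k)"
  shows "f x = g x"
  using qlinear_ext_on assms by blast

lemma qlinear_ext_span:
  assumes "qlinear f" "qlinear g" "x \<in> pm.span S" "\<And>s. s \<in> S \<Longrightarrow> f s = g s"
  shows "f x = g x"
  using assms(3)
  by (induction rule: pm.span_induct_alt)
    (simp_all add: qlinear_0 qlinear_add qlinear_sc assms)

text \<open>The sums over \<open>keys\<close> in the definitions are instances or nestings of this
  extension. Rewriting them so makes linearity automatic and reduces identities to basis
  elements.\<close>

definition lin :: "('a \<Rightarrow> 'b \<Rightarrow>\<^sub>0 rat) \<Rightarrow> ('a \<Rightarrow>\<^sub>0 rat) \<Rightarrow> 'b \<Rightarrow>\<^sub>0 rat" where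
  "lin f x = (\<Sum>k\<in>Poly_Mapping.keys x. sc (coef x k) (f k))"

lemma lin_eq_sum_superset:
  "finite A \<Longrightarrow> Poly_Mapping.keys x \<subseteq> A \<Longrightarrow> lin f x = (\<Sum>k\<in>A. sc (coef x k) (f k))"
  unfolding lin_def by (rule sum.mono_neutral_left) (auto simp: in_keys_iff)

lemma qlinear_lin [qlin]: "qlinear (lin f)"
proof (rule qlinearI)
  fix x y :: "'a \<Rightarrow>\<^sub>0 rat" and c
  let ?A = "Poly_Mapping.keys x \<union> Poly_Mapping.keys y"
  have "Poly_Mapping.keys (x + y) \<subseteq> ?A" by (rule keys_add)
  then show "lin f (x + y) = lin f x + lin f y"
    using lin_eq_sum_superset[of ?A _ f]
    by (simp add: lookup_add sum.distrib pm.scale_left_distrib)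
  have "Poly_Mapping.keys (sc c x) \<subseteq> Poly_Mapping.keys x"
    by (auto simp: in_keys_iff)
  then show "lin f (sc c x) = sc c (lin f x)"
    by (subst lin_eq_sum_superset[of "Poly_Mapping.keys x"])
      (simp_all add: lin_def pm.scale_sum_right)
qed

lemma lin_bas [simp]: "lin f (bas k) = f k"
  by (simp add: lin_def)

lemma qlinear_lin_comp [qlin]: "qlinear g \<Longrightarrow> qlinear (\<lambda>x. lin f (g x))"
  by (rule qlinear_compose[OF qlinear_lin])

lemma lookup_lin: "coef (lin f x) j = (\<Sum>k\<in>Poly_Mapping.keys x. coef x k * coef (f k) j)"
  by (simp add: lin_def lookup_sum)

lemma keys_lin: "Poly_Mapping.keys (lin f x) \<subseteq> (\<Union>k\<in>Poly_Mapping.keys x. Poly_Mapping.keys (f k))"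
proof
  fix j assume "j \<in> Poly_Mapping.keys (lin f x)"
  then have "(\<Sum>k\<in>Poly_Mapping.keys x. coef x k * coef (f k) j) \<noteq> 0"
    by (simp add: in_keys_iff lookup_lin)
  then obtain k where "k \<in> Poly_Mapping.keys x" "coef x k * coef (f k) j \<noteq> 0"
    by (meson sum.not_neutral_contains_not_neutral)
  then show "j \<in> (\<Union>k\<in>Poly_Mapping.keys x. Poly_Mapping.keys (f k))"
    by (auto simp: in_keys_iff)
qed

lemma lin_qlinear: "qlinear g \<Longrightarrow> lin (\<lambda>k. g (bas k)) x = g x"
  by (rule qlinear_ext) (simp_all add: qlinear_lin)

lemma qlinear_lin_fun [qlin]:
  assumes "\<And>k. qlinear (\<lambda>x. f x k)"
  shows "qlinear (\<lambda>x. lin (f x) y)"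
  unfolding lin_def by (intro qlin assms)

lemma sc_mult_left: "sc c x * y = sc c (x * y)"
  and sc_mult_right: "x * sc c y = sc c (x * y)"
  for x y :: "'a::comm_monoid_add \<Rightarrow>\<^sub>0 rat"
  unfolding sc_def mult_map_scale_conv_mult by (simp_all add: ac_simps)

lemma qlinear_times_left [qlin]: "qlinear f \<Longrightarrow> qlinear (\<lambda>x. f x * (y :: 'a::comm_monoid_add \<Rightarrow>\<^sub>0 rat))"
  by (simp add: qlinear_def distrib_right sc_mult_left)

lemma qlinear_times_right [qlin]: "qlinear f \<Longrightarrow> qlinear (\<lambda>x. (y :: 'a::comm_monoid_add \<Rightarrow>\<^sub>0 rat) * f x)"
  by (simp add: qlinear_def distrib_left sc_mult_right)

lemma bas_mult: "bas j * bas k = bas (j + k)" for j k :: "'a::comm_monoid_add"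
  by (simp add: mult_single)

lemma lin_mult:
  fixes f :: "'a::comm_monoid_add \<Rightarrow> 'b::comm_monoid_add \<Rightarrow>\<^sub>0 rat"
  assumes "\<And>j k. f (j + k) = f j * f k"
  shows "lin f (x * y) = lin f x * lin f y"
proof (rule qlinear_ext[of "\<lambda>x. lin f (x * y)" "\<lambda>x. lin f x * lin f y"])
  fix j
  show "lin f (bas j * y) = lin f (bas j) * lin f y"
    by (rule qlinear_ext[where x = y], (intro qlin)+) (simp add: bas_mult assms)
qed (intro qlin)+

subsection \<open>Tensor products\<close>

text \<open>A polymorphic \<open>tensor2\<close>: triple tensors and tensors mixing forests with
  letters occur as well.\<close>

definition tens :: "('a \<Rightarrow>\<^sub>0 rat) \<Rightarrow> ('b \<Rightarrow>\<^sub>0 rat) \<Rightarrow> ('a \<times> 'b) \<Rightarrow>\<^sub>0 rat" where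
  "tens x y = lin (\<lambda>a. lin (\<lambda>b. bas (a, b)) y) x"

lemma qlinear_tens_left [qlin]: "qlinear f \<Longrightarrow> qlinear (\<lambda>x. tens (f x) y)"
  unfolding tens_def by (intro qlin)

lemma qlinear_tens_right [qlin]: "qlinear f \<Longrightarrow> qlinear (\<lambda>x. tens y (f x))"
  unfolding tens_def by (intro qlin)

lemma tens_bas [simp]: "tens (bas a) (bas b) = bas (a, b)"
  by (simp add: tens_def)

lemmas tens_linear_left = qlinear_add[OF qlinear_tens_left[OF qlinear_ident]]
  qlinear_diff[OF qlinear_tens_left[OF qlinear_ident]]
  qlinear_sc[OF qlinear_tens_left[OF qlinear_ident]]
  qlinear_0[OF qlinear_tens_left[OF qlinear_ident]]
  qlinear_sum[OF qlinear_tens_left[OF qlinear_ident]]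

lemmas tens_linear_right = qlinear_add[OF qlinear_tens_right[OF qlinear_ident]]
  qlinear_diff[OF qlinear_tens_right[OF qlinear_ident]]
  qlinear_sc[OF qlinear_tens_right[OF qlinear_ident]]
  qlinear_0[OF qlinear_tens_right[OF qlinear_ident]]
  qlinear_sum[OF qlinear_tens_right[OF qlinear_ident]]

lemma tensor2_eq_tens: "tensor2 = tens"
  unfolding tensor2_def tens_def lin_def
  by (intro ext) (simp add: pm.scale_sum_right single_eq_sc_bas[of _ "_ * _"])

lemma lookup_tens [simp]: "coef (tens x y) (a, b) = coef x a * coef y b"
proof -
  have 1: "coef (lin (\<lambda>b. bas (a', b)) y) (a, b) = (if a' = a then coef y b else 0)" for a'
    by (auto simp: lookup_lin lookup_single when_def sum.delta if_distrib in_keys_iff cong: if_cong)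
  show ?thesis
    unfolding tens_def by (subst lookup_lin)
      (simp add: 1 sum.delta if_distrib in_keys_iff cong: if_cong)
qed

definition tm :: "(('a \<Rightarrow>\<^sub>0 rat) \<Rightarrow> 'c \<Rightarrow>\<^sub>0 rat) \<Rightarrow> (('b \<Rightarrow>\<^sub>0 rat) \<Rightarrow> 'd \<Rightarrow>\<^sub>0 rat)
    \<Rightarrow> ('a \<times> 'b \<Rightarrow>\<^sub>0 rat) \<Rightarrow> 'c \<times> 'd \<Rightarrow>\<^sub>0 rat" where
  "tm f g = lin (\<lambda>(a, b). tens (f (bas a)) (g (bas b)))"

lemma tmap2_eq_tm: "tmap2 = tm"
  unfolding tmap2_def tm_def lin_def tensor2_eq_tens by (intro ext) (simp add: case_prod_beta)

lemma qlinear_tm [qlin]: "qlinear h \<Longrightarrow> qlinear (\<lambda>x. tm f g (h x))"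
  unfolding tm_def by (intro qlin)

lemma qlinear_tm' [qlin]: "qlinear (tm f g)"
  unfolding tm_def by (intro qlin)

lemma tm_bas: "tm f g (bas (a, b)) = tens (f (bas a)) (g (bas b))"
  by (simp add: tm_def)

lemma tm_tens:
  assumes "qlinear f" "qlinear g"
  shows "tm f g (tens x y) = tens (f x) (g y)"
proof (rule qlinear_ext[of "\<lambda>x. tm f g (tens x y)" "\<lambda>x. tens (f x) (g y)"])
  fix j
  show "tm f g (tens (bas j) y) = tens (f (bas j)) (g y)"
    by (rule qlinear_ext[where x = y], (intro qlin assms)+) (simp add: tm_bas)
qed (intro qlin assms)+

lemma tm_comp:
  assumes "qlinear f" "qlinear g"
  shows "tm f g (tm f' g' z) = tm (\<lambda>x. f (f' x)) (\<lambda>x. g (g' x)) z"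
  by (rule qlinear_ext[where x = z], (intro qlin)+) (auto simp: tm_bas tm_tens assms)

lemma tm_id: "tm (\<lambda>x. x) (\<lambda>x. x) z = z"
  by (rule qlinear_ext[where x = z], (intro qlin)+) (auto simp: tm_bas)

lemma tm_id_fun: "tm (\<lambda>x. x) (\<lambda>x. x) = (\<lambda>z. z)"
  by (rule ext) (rule tm_id)

lemma tens_mult:
  fixes x x' :: "'a::comm_monoid_add \<Rightarrow>\<^sub>0 rat" and y y' :: "'b::comm_monoid_add \<Rightarrow>\<^sub>0 rat"
  shows "tens x y * tens x' y' = tens (x * x') (y * y')"
proof -
  have 4: "tens (bas a) (bas b) * tens (bas a') (bas b') = tens (bas a * bas a') (bas b * bas b')"
    for a a' :: 'a and b b' :: 'b
    by (simp add: bas_mult)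
  have 3: "tens (bas a) (bas b) * tens (bas a') y' = tens (bas a * bas a') (bas b * y')"
    for a a' :: 'a and b :: 'b
    by (rule qlinear_ext[where x = y']) ((intro qlin)+, rule 4)
  have 2: "tens (bas a) (bas b) * tens x' y' = tens (bas a * x') (bas b * y')"
    for a :: 'a and b :: 'b
    by (rule qlinear_ext[where x = x']) ((intro qlin)+, rule 3)
  have 1: "tens (bas a) y * tens x' y' = tens (bas a * x') (y * y')" for a :: 'a
    by (rule qlinear_ext[where x = y]) ((intro qlin)+, rule 2)
  show ?thesis
    by (rule qlinear_ext[where x = x]) ((intro qlin)+, rule 1)
qed

subsection \<open>The coproduct of a tree through its root\<close>

definition bplus :: "H \<Rightarrow> H" where
  "bplus = lin (\<lambda>F. bas {#Node F#})"

lemma qlinear_bplus [qlin]: "qlinear bplus"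
  unfolding bplus_def by (intro qlin)

lemma bplus_bas [simp]: "bplus (bas F) = bas {#Node F#}"
  by (simp add: bplus_def)

definition bplus2 :: "H2 \<Rightarrow> H2" where
  "bplus2 = tm (\<lambda>x. x) bplus"

lemma qlinear_bplus2 [qlin]: "qlinear f \<Longrightarrow> qlinear (\<lambda>x. bplus2 (f x))"
  unfolding bplus2_def by (intro qlin)

lemma qlinear_bplus2' [qlin]: "qlinear bplus2"
  unfolding bplus2_def by (intro qlin)

lemma bplus2_bas [simp]: "bplus2 (bas (a, b)) = bas (a, {#Node b#})"
  by (simp add: bplus2_def tm_bas)

section \<open>Cuts of planar trees as antichains of addresses\<close>

lemma finite_valid_addr: "finite {a. valid_addr p a}"
proof (induction p)
  case (PNode ts)
  have "{a. valid_addr (PNode ts) a} \<subseteq> insert [] (\<Union>i<length ts. (#) i ` {a. valid_addr (ts ! i) a})"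
  proof
    fix a assume "a \<in> {a. valid_addr (PNode ts) a}"
    then show "a \<in> insert [] (\<Union>i<length ts. (#) i ` {a. valid_addr (ts ! i) a})"
      by (cases a) auto
  qed
  moreover have "finite (insert [] (\<Union>i<length ts. (#) i ` {a. valid_addr (ts ! i) a}))"
    using PNode by auto
  ultimately show ?case by (rule finite_subset)
qed

definition antichain :: "'a list set \<Rightarrow> bool" where
  "antichain C \<longleftrightarrow> (\<forall>a\<in>C. \<forall>b\<in>C. (\<exists>c. b = a @ c) \<longrightarrow> a = b)"

lemma antichainI: "(\<And>a c. a \<in> C \<Longrightarrow> a @ c \<in> C \<Longrightarrow> c = []) \<Longrightarrow> antichain C"
  unfolding antichain_def by blast

lemma antichainD: "antichain C \<Longrightarrow> a \<in> C \<Longrightarrow> a @ c \<in> C \<Longrightarrow> c = []"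
  unfolding antichain_def by (metis append_self_conv)

text \<open>Cuts of a tree, the empty cut and the cut above the root included; the latter
  is the antichain consisting of the empty address.\<close>
definition ecuts :: "ptree \<Rightarrow> nat list set set" where
  "ecuts p = {C. C \<subseteq> {a. valid_addr p a} \<and> antichain C}"

text \<open>Cuts of the branches hanging from a root, still addressed from that root. Each branch
  may be removed whole or left uncut, so this indexes the coproduct of the forest
  \<open>ts\<close>.\<close>

definition lcuts :: "ptree list \<Rightarrow> nat list set set" where
  "lcuts ts = {C. C \<subseteq> {i # a |i a. i < length ts \<and> valid_addr (ts ! i) a} \<and> antichain C}"

primrec lprune :: "ptree list \<Rightarrow> nat list set \<Rightarrow> ptree list" where
  "lprune [] C = []"
| "lprune (t # ts) C = (if [0] \<in> C then [] else [prune t {a. 0 # a \<in> C}])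
     @ lprune ts {i # a |i a. Suc i # a \<in> C}"

text \<open>The offset \<open>k\<close> is for the induction: \<open>prune\<close> numbers all
  children from 0 at once, while \<open>lprune\<close> renumbers the remaining ones after every
  step.\<close>

lemma lprune_offset:
  "map (\<lambda>(i, f). f {a. i # a \<in> C}) (filter (\<lambda>(i, f). [i] \<notin> C)
      (zip [k..<k + length ts] (map prune ts)))
   = lprune ts {i # a |i a. (k + i) # a \<in> C}"
proof (induction ts arbitrary: k)
  case (Cons t ts)
  have "[k..<k + length (t # ts)] = k # [Suc k..<Suc k + length ts]"
    by (simp add: upt_conv_Cons del: upt_Suc)
  moreover have "{i # a |i a. Suc i # a \<in> {i # a |i a. (k + i) # a \<in> C}}
      = {i # a |i a. (Suc k + i) # a \<in> C}"
    by auto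
  ultimately show ?case
    using Cons[of "Suc k"] by simp
qed simp

lemma prune_eq_lprune: "C \<subseteq> {a. a \<noteq> []} \<Longrightarrow> prune (PNode ts) C = PNode (lprune ts C)"
proof -
  assume "C \<subseteq> {a. a \<noteq> []}"
  then have "{i # a |i a. (0 + i) # a \<in> C} = C"
    by (auto simp: neq_Nil_conv)
  then show ?thesis
    using lprune_offset[of C 0 ts] by simp
qed

definition esum :: "ptree \<Rightarrow> H2" where
  "esum p = (\<Sum>C\<in>ecuts p. bas (cut_P p C, if [] \<in> C then {#} else {#to_tree (prune p C)#}))"

definition lsum :: "ptree list \<Rightarrow> H2" where
  "lsum ts = (\<Sum>C\<in>lcuts ts. bas (cut_P (PNode ts) C, mset (map to_tree (lprune ts C))))"

lemma finite_ecuts: "finite (ecuts p)"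
  unfolding ecuts_def
  by (rule finite_subset[of _ "Pow {a. valid_addr p a}"]) (auto simp: finite_valid_addr)

lemma lcuts_subset_ecuts: "lcuts ts \<subseteq> ecuts (PNode ts)"
  unfolding lcuts_def ecuts_def by auto

lemma finite_lcuts: "finite (lcuts ts)"
  using finite_subset[OF lcuts_subset_ecuts finite_ecuts] .

lemma finite_mem_ecuts: "C \<in> ecuts p \<Longrightarrow> finite C"
  unfolding ecuts_def using finite_subset[OF _ finite_valid_addr] by auto

lemma ecuts_PNode: "ecuts (PNode ts) = insert {[]} (lcuts ts)"
proof (intro equalityI subsetI)
  fix C assume C: "C \<in> ecuts (PNode ts)"
  show "C \<in> insert {[]} (lcuts ts)"
  proof (cases "[] \<in> C")
    case True
    then have "\<And>b. b \<in> C \<Longrightarrow> b = []"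
      using C antichainD[of C "[]"] by (simp add: ecuts_def)
    then show ?thesis using True by auto
  next
    case False
    have "\<exists>i b. a = i # b \<and> i < length ts \<and> valid_addr (ts ! i) b" if "a \<in> C" for a
      using that False C by (cases a) (auto simp: ecuts_def)
    then show ?thesis
      using C unfolding lcuts_def ecuts_def by (intro insertI2 CollectI conjI subsetI) auto
  qed
next
  fix C assume "C \<in> insert {[]} (lcuts ts)"
  moreover have "{[]} \<in> ecuts (PNode ts)" by (simp add: ecuts_def antichain_def)
  ultimately show "C \<in> ecuts (PNode ts)"
    using lcuts_subset_ecuts[of ts] by auto
qed

lemma adm_cuts_PNode: "adm_cuts (PNode ts) = lcuts ts - {{}}"
proof -
  have "{a. a \<noteq> [] \<and> valid_addr (PNode ts) a} = {i # a |i a. i < length ts \<and> valid_addr (ts ! i) a}"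
  proof (intro equalityI subsetI)
    fix a assume "a \<in> {a. a \<noteq> [] \<and> valid_addr (PNode ts) a}"
    then show "a \<in> {i # a |i a. i < length ts \<and> valid_addr (ts ! i) a}"
      by (cases a) auto
  qed auto
  then show ?thesis
    unfolding adm_cuts_def lcuts_def antichain_def by auto
qed

definition joincut :: "nat list set \<Rightarrow> nat list set \<Rightarrow> nat list set" where
  "joincut A D = (#) 0 ` A \<union> {Suc i # a |i a. i # a \<in> D}"

lemma joincut_head: "{a. 0 # a \<in> joincut A D} = A"
  and joincut_tail: "D \<subseteq> {a. a \<noteq> []} \<Longrightarrow> {i # a |i a. Suc i # a \<in> joincut A D} = D"
  by (auto simp: joincut_def neq_Nil_conv)

lemma lcuts_nonempty: "D \<in> lcuts ts \<Longrightarrow> D \<subseteq> {a. a \<noteq> []}"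
  by (auto simp: lcuts_def)

text \<open>Addresses that begin with different child indices are never prefixes of each other, so
  the antichain condition can be tested on the first tree and on the rest separately.\<close>

lemma bij_betw_joincut:
  "bij_betw (\<lambda>(A, D). joincut A D) (ecuts t \<times> lcuts ts) (lcuts (t # ts))"
proof (rule bij_betw_byWitness[where f' = "\<lambda>C. ({a. 0 # a \<in> C}, {i # a |i a. Suc i # a \<in> C})"])
  show "\<forall>p\<in>ecuts t \<times> lcuts ts. ({a. 0 # a \<in> (case p of (A, D) \<Rightarrow> joincut A D)},
      {i # a |i a. Suc i # a \<in> (case p of (A, D) \<Rightarrow> joincut A D)}) = p"
    by (clarify, subst joincut_head, subst joincut_tail[OF lcuts_nonempty]) simp_all
  show "\<forall>C\<in>lcuts (t # ts). (case ({a. 0 # a \<in> C}, {i # a |i a. Suc i # a \<in> C}) of (A, D) \<Rightarrow> joincut A D) = C"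
  proof
    fix C assume C: "C \<in> lcuts (t # ts)"
    have "a \<in> joincut {a. 0 # a \<in> C} {i # a |i a. Suc i # a \<in> C} \<longleftrightarrow> a \<in> C" for a
    proof (cases a)
      case Nil
      then show ?thesis using lcuts_nonempty[OF C] by (auto simp: joincut_def)
    next
      case (Cons i b)
      then show ?thesis by (cases i) (auto simp: joincut_def)
    qed
    then show "(case ({a. 0 # a \<in> C}, {i # a |i a. Suc i # a \<in> C}) of (A, D) \<Rightarrow> joincut A D) = C"
      by auto
  qed
  show "(\<lambda>(A, D). joincut A D) ` (ecuts t \<times> lcuts ts) \<subseteq> lcuts (t # ts)"
  proof clarify
    fix A D assume A: "A \<in> ecuts t" and D: "D \<in> lcuts ts"
    have aA: "antichain A" and aD: "antichain D"
      using A D by (simp_all add: ecuts_def lcuts_def)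
    have "antichain (joincut A D)"
    proof (rule antichainI)
      fix a c assume a: "a \<in> joincut A D" and ac: "a @ c \<in> joincut A D"
      from a consider b where "a = 0 # b" "b \<in> A" | i b where "a = Suc i # b" "i # b \<in> D"
        by (auto simp: joincut_def)
      then show "c = []"
      proof cases
        case 1
        then show ?thesis using ac antichainD[OF aA, of b c] by (auto simp: joincut_def)
      next
        case 2
        then show ?thesis using ac antichainD[OF aD, of "i # b" c] by (auto simp: joincut_def)
      qed
    qed
    moreover have "joincut A D \<subseteq> {i # a |i a. i < length (t # ts) \<and> valid_addr ((t # ts) ! i) a}"
      using A D by (force simp: ecuts_def lcuts_def joincut_def)
    ultimately show "joincut A D \<in> lcuts (t # ts)"
      by (simp add: lcuts_def)
  qed
  show "(\<lambda>C. ({a. 0 # a \<in> C}, {i # a |i a. Suc i # a \<in> C})) ` lcuts (t # ts) \<subseteq> ecuts t \<times> lcuts ts"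
  proof clarify
    fix C assume C: "C \<in> lcuts (t # ts)"
    then have aC: "antichain C" and sub: "\<And>i a. i # a \<in> C \<Longrightarrow> i < length (t # ts) \<and> valid_addr ((t # ts) ! i) a"
      by (auto simp: lcuts_def)
    have "antichain {a. 0 # a \<in> C}"
      using antichainD[OF aC, of "0 # a" for a] by (intro antichainI) simp
    moreover have "antichain {i # a |i a. Suc i # a \<in> C}"
    proof (rule antichainI)
      fix a c assume "a \<in> {i # a |i a. Suc i # a \<in> C}" "a @ c \<in> {i # a |i a. Suc i # a \<in> C}"
      then show "c = []" using antichainD[OF aC, of "Suc i # b" c for i b] by auto
    qed
    ultimately show "{a. 0 # a \<in> C} \<in> ecuts t \<and> {i # a |i a. Suc i # a \<in> C} \<in> lcuts ts"
      using sub[of 0] sub[of "Suc i" for i] by (auto simp: lcuts_def ecuts_def)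
  qed
qed

lemma cut_P_joincut:
  assumes A: "A \<in> ecuts t" and D: "D \<in> lcuts ts"
  shows "cut_P (PNode (t # ts)) (joincut A D) = cut_P t A + cut_P (PNode ts) D"
proof -
  define sh :: "nat list \<Rightarrow> nat list" where "sh = (\<lambda>a. Suc (hd a) # tl a)"
  have fin: "finite A" "finite D"
    using finite_mem_ecuts A D lcuts_subset_ecuts by blast+
  have ne: "\<And>a. a \<in> D \<Longrightarrow> a \<noteq> []" using lcuts_nonempty[OF D] by auto
  have "{Suc i # a |i a. i # a \<in> D} = sh ` D"
    using ne by (force simp: sh_def image_iff neq_Nil_conv)
  then have "mset_set (joincut A D) = mset_set ((#) 0 ` A) + mset_set (sh ` D)"
    unfolding joincut_def using fin by (simp, subst mset_set_Union) (auto simp: sh_def)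
  also have "\<dots> = image_mset ((#) 0) (mset_set A) + image_mset sh (mset_set D)"
  proof -
    have "inj_on sh D"
      using ne by (auto simp: inj_on_def sh_def intro: list.expand)
    then show ?thesis by (simp add: image_mset_mset_set)
  qed
  finally have "cut_P (PNode (t # ts)) (joincut A D) = cut_P t A
      + image_mset (\<lambda>a. to_tree (subt (PNode (t # ts)) (sh a))) (mset_set D)"
    by (simp add: cut_P_def multiset.map_comp comp_def)
  also have "image_mset (\<lambda>a. to_tree (subt (PNode (t # ts)) (sh a))) (mset_set D) = cut_P (PNode ts) D"
    unfolding cut_P_def
  proof (rule image_mset_cong)
    fix a assume "a \<in># mset_set D"
    then have "a \<noteq> []" using ne fin by auto
    then show "to_tree (subt (PNode (t # ts)) (sh a)) = to_tree (subt (PNode ts) a)"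
      by (cases a) (auto simp: sh_def)
  qed
  finally show ?thesis .
qed

text \<open>Multiplicativity of the coproduct in planar form: the two cuts are independent, and
  their pruned parts and root parts are united as multisets.\<close>

lemma lsum_Cons: "lsum (t # ts) = esum t * lsum ts"
proof -
  have "lsum (t # ts) = (\<Sum>(A, D)\<in>ecuts t \<times> lcuts ts.
      bas (cut_P (PNode (t # ts)) (joincut A D), mset (map to_tree (lprune (t # ts) (joincut A D)))))"
    unfolding lsum_def
    by (subst sum.reindex_bij_betw[OF bij_betw_joincut, symmetric]) (simp add: case_prod_beta)
  also have "\<dots> = (\<Sum>(A, D)\<in>ecuts t \<times> lcuts ts.
      bas (cut_P t A, if [] \<in> A then {#} else {#to_tree (prune t A)#})
      * bas (cut_P (PNode ts) D, mset (map to_tree (lprune ts D))))"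
  proof (intro sum.cong refl, clarify)
    fix A D assume A: "A \<in> ecuts t" and D: "D \<in> lcuts ts"
    have "[0] \<in> joincut A D \<longleftrightarrow> [] \<in> A"
      using joincut_head[of A D] by auto
    then have "mset (map to_tree (lprune (t # ts) (joincut A D)))
        = (if [] \<in> A then {#} else {#to_tree (prune t A)#}) + mset (map to_tree (lprune ts D))"
      by (simp add: joincut_head joincut_tail[OF lcuts_nonempty[OF D]])
    then show "bas (cut_P (PNode (t # ts)) (joincut A D), mset (map to_tree (lprune (t # ts) (joincut A D))))
       = bas (cut_P t A, if [] \<in> A then {#} else {#to_tree (prune t A)#})
        * bas (cut_P (PNode ts) D, mset (map to_tree (lprune ts D)))"
      unfolding bas_mult cut_P_joincut[OF A D] by simp
  qed
  also have "\<dots> = esum t * lsum ts"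
    unfolding esum_def lsum_def by (simp add: sum_product sum.cartesian_product)
  finally show ?thesis .
qed

lemma lsum_Nil: "lsum [] = 1"
proof -
  have "lcuts [] = {{}}" by (auto simp: lcuts_def antichain_def)
  then show ?thesis by (simp add: lsum_def cut_P_def flip: zero_prod_def)
qed

text \<open>The cut above the root gives the first term. Any other cut leaves the root in place and
  is a cut of the forest of branches, whose root part goes back under the root.\<close>

lemma esum_PNode: "esum (PNode ts) = bas ({#to_tree (PNode ts)#}, {#}) + bplus2 (lsum ts)"
proof -
  have "{[]} \<notin> lcuts ts" using lcuts_nonempty by blast
  then have "esum (PNode ts) = bas ({#to_tree (PNode ts)#}, {#}) + (\<Sum>C\<in>lcuts ts.
      bas (cut_P (PNode ts) C, if [] \<in> C then {#} else {#to_tree (prune (PNode ts) C)#}))"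
    unfolding esum_def ecuts_PNode by (simp add: finite_lcuts cut_P_def)
  also have "(\<Sum>C\<in>lcuts ts. bas (cut_P (PNode ts) C, if [] \<in> C then {#} else {#to_tree (prune (PNode ts) C)#}))
      = bplus2 (lsum ts)"
    unfolding lsum_def qlinear_sum[OF qlinear_bplus2']
  proof (intro sum.cong refl)
    fix C assume "C \<in> lcuts ts"
    then have C: "C \<subseteq> {a. a \<noteq> []}" by (rule lcuts_nonempty)
    then have "[] \<notin> C" by auto
    then show "bas (cut_P (PNode ts) C, if [] \<in> C then {#} else {#to_tree (prune (PNode ts) C)#})
        = bplus2 (bas (cut_P (PNode ts) C, mset (map to_tree (lprune ts C))))"
      unfolding prune_eq_lprune[OF C] by simp
  qed
  finally show ?thesis .
qed

lemma lsum_eq_prod_list: "lsum ts = prod_list (map esum ts)"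
  by (induction ts) (simp_all add: lsum_Nil lsum_Cons)

text \<open>The recursion refers to the isomorphism class alone, so agreement with
  \<open>esum\<close> shows that the sum over cuts does not depend on the planar
  representative.\<close>

primrec dtree :: "tree \<Rightarrow> H2" where
  "dtree (Node cs) = bas ({#Node cs#}, {#}) + bplus2 (prod_mset (image_mset dtree cs))"

lemma esum_eq_dtree: "esum p = dtree (to_tree p)"
proof (induction p)
  case (PNode ts)
  then have "map esum ts = map (\<lambda>p. dtree (to_tree p)) ts" by simp
  then have "lsum ts = prod_list (map (\<lambda>p. dtree (to_tree p)) ts)"
    by (simp only: lsum_eq_prod_list)
  also have "\<dots> = prod_mset (image_mset dtree (mset (map to_tree ts)))"
    by (simp add: prod_mset_prod_list flip: mset_map) (simp add: comp_def)
  finally show ?case by (simp add: esum_PNode)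
qed

lemma ex_to_tree: "\<exists>p. to_tree p = t"
proof (induction t)
  case (Node cs)
  then obtain f where f: "\<And>c. c \<in># cs \<Longrightarrow> to_tree (f c) = c" by metis
  obtain xs where xs: "mset xs = cs" using ex_mset by blast
  have "map (\<lambda>c. to_tree (f c)) xs = xs"
    using f xs by (intro map_idI) auto
  then have "to_tree (PNode (map f xs)) = Node cs"
    using xs by (simp add: comp_def)
  then show ?case by blast
qed

text \<open>The \<open>SOME\<close> representative disappears here. The cut \<open>{[]}\<close>
  gives t \<otimes> 1, \<open>{}\<close> gives 1 \<otimes> t, and the remaining elements of
  \<open>ecuts\<close> are the admissible cuts.\<close>

lemma Delta_tree_eq_dtree: "Delta_tree t = dtree t"
proof -
  define p where "p = (SOME p. to_tree p = t)"
  have p: "to_tree p = t" unfolding p_def by (rule someI_ex[OF ex_to_tree])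
  obtain ts where ts: "p = PNode ts" by (cases p)
  have ne: "[] \<notin> C" if "C \<in> lcuts ts" for C using lcuts_nonempty[OF that] by auto
  have emp: "{} \<in> lcuts ts" by (auto simp: lcuts_def antichain_def)
  have pr: "to_tree (prune p {}) = t"
  proof -
    have "lprune ss {} = ss" if "\<And>s. s \<in> set ss \<Longrightarrow> prune s {} = s" for ss
      using that by (induction ss) auto
    moreover have "prune q {} = q" for q
      by (induction q) (simp add: prune_eq_lprune calculation del: prune.simps)
    ultimately show ?thesis using p by simp
  qed
  have "esum p = bas ({#t#}, {#}) + (\<Sum>C\<in>lcuts ts.
      bas (cut_P p C, if [] \<in> C then {#} else {#to_tree (prune p C)#}))"
    unfolding esum_def ts ecuts_PNode using ne p ts by (subst sum.insert) (auto simp: finite_lcuts cut_P_def)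
  also have "(\<Sum>C\<in>lcuts ts. bas (cut_P p C, if [] \<in> C then {#} else {#to_tree (prune p C)#}))
      = (\<Sum>C\<in>lcuts ts. bas (cut_P p C, {#cut_R p C#}))"
    by (intro sum.cong refl) (simp add: ne cut_R_def)
  also have "\<dots> = bas ({#}, {#t#}) + (\<Sum>C\<in>adm_cuts p. bas (cut_P p C, {#cut_R p C#}))"
    using emp by (subst sum.remove[OF finite_lcuts emp]) (simp add: ts adm_cuts_PNode cut_P_def cut_R_def pr[unfolded ts] del: prune.simps)
  finally have "esum p = Delta_tree t"
    by (simp add: Delta_tree_def Let_def p_def[symmetric] add_ac)
  then show ?thesis by (simp add: esum_eq_dtree p)
qed

lemma Delta_eq_lin: "Delta = lin Delta_forest"
  by (rule ext) (simp add: Delta_def lin_def)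

lemma qlinear_Delta [qlin]: "qlinear Delta"
  unfolding Delta_eq_lin by (intro qlin)

lemma Delta_bas: "Delta (bas F) = Delta_forest F"
  by (simp add: Delta_eq_lin)

lemma Delta_forest_add: "Delta_forest (F + G) = Delta_forest F * Delta_forest G"
  by (simp add: Delta_forest_def)

lemma Delta_mult: "Delta (x * y) = Delta x * Delta y"
  unfolding Delta_eq_lin by (rule lin_mult) (rule Delta_forest_add)

lemma Delta_forest_empty: "Delta_forest {#} = 1"
  by (simp add: Delta_forest_def)

lemma Delta_one: "Delta 1 = 1"
  using Delta_bas[of "{#}"] by (simp add: Delta_forest_empty)

lemma Delta_bas_empty: "Delta (bas {#}) = bas ({#}, {#})"
  unfolding Delta_bas Delta_forest_empty by (simp add: zero_prod_def flip: single_one)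

lemma Delta_forest_tree: "Delta_forest {#Node cs#} = bas ({#Node cs#}, {#}) + bplus2 (Delta_forest cs)"
  unfolding Delta_forest_def Delta_tree_eq_dtree by simp

text \<open>The Hochschild 1-cocycle property of the operator usually written B+.\<close>

lemma Delta_bplus: "Delta (bplus x) = tens (bplus x) 1 + bplus2 (Delta x)"
  by (rule qlinear_ext[where x = x], (intro qlin qlinear_compose[OF qlinear_Delta] qlinear_Delta)+)
    (simp add: Delta_bas Delta_forest_tree flip: single_one)

lemma forest_induct [case_names empty add Node]:
  assumes "P {#}" "\<And>F G. P F \<Longrightarrow> P G \<Longrightarrow> P (F + G)" "\<And>F. P F \<Longrightarrow> P {#Node F#}"
  shows "P F"
proof -
  have *: "P F" if "\<And>t. t \<in># F \<Longrightarrow> P {#t#}" for F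
    using that assms(2)[of "{#_#}"] by (induction F) (auto simp: assms(1))
  have "P {#t#}" for t
    by (induction t) (auto intro: assms(3) *)
  then show ?thesis using * by blast
qed

subsection \<open>Coassociativity, counit and grading\<close>

lemma one_eq_tens: "(1 :: ('a::comm_monoid_add \<times> 'b::comm_monoid_add) \<Rightarrow>\<^sub>0 rat) = tens 1 1"
  by (simp add: zero_prod_def flip: single_one)

definition assocr :: "(('a \<times> 'b) \<times> 'c \<Rightarrow>\<^sub>0 rat) \<Rightarrow> ('a \<times> 'b \<times> 'c \<Rightarrow>\<^sub>0 rat)" where
  "assocr = lin (\<lambda>((a, b), c). bas (a, b, c))"

lemma qlinear_assocr: "qlinear assocr"
  unfolding assocr_def by (intro qlin)

lemma qlinear_assocr_comp [qlin]: "qlinear f \<Longrightarrow> qlinear (\<lambda>x. assocr (f x))"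
  by (rule qlinear_compose[OF qlinear_assocr])

lemma assocr_tens: "assocr (tens (tens x y) z) = tens x (tens y z)"
proof -
  have 3: "assocr (tens (tens (bas a) (bas b)) (bas c)) = tens (bas a) (tens (bas b) (bas c))"
    for a :: 'a and b :: 'b and c :: 'c
    by (simp add: assocr_def)
  have 2: "assocr (tens (tens (bas a) (bas b)) z) = tens (bas a) (tens (bas b) z)"
    for a :: 'a and b :: 'b
    by (rule qlinear_ext[where x = z]) ((intro qlin)+, rule 3)
  have 1: "assocr (tens (tens (bas a) y) z) = tens (bas a) (tens y z)" for a :: 'a
    by (rule qlinear_ext[where x = y]) ((intro qlin)+, rule 2)
  show ?thesis
    by (rule qlinear_ext[where x = x]) ((intro qlin)+, rule 1)
qed

lemma assocr_mult: "assocr (x * y) = assocr x * assocr y"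
  for x :: "('a::comm_monoid_add \<times> 'b::comm_monoid_add) \<times> 'c::comm_monoid_add \<Rightarrow>\<^sub>0 rat"
  unfolding assocr_def by (rule lin_mult) (auto simp: bas_mult)

lemma lookup_assocr: "coef (assocr z) (a, b, c) = coef z ((a, b), c)"
proof -
  have "coef (assocr z) (a, b, c) = (\<Sum>k\<in>Poly_Mapping.keys z. if k = ((a, b), c) then coef z k else 0)"
    unfolding assocr_def lookup_lin
    by (intro sum.cong) (auto simp: lookup_single when_def split: prod.splits)
  then show ?thesis
    by (simp add: sum.delta in_keys_iff)
qed

lemma tm_assocr:
  assumes "qlinear f" "qlinear g" "qlinear h"
  shows "tm f (tm g h) (assocr z) = assocr (tm (tm f g) h z)"
  by (rule qlinear_ext[where x = z], (intro qlin)+)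
    (auto simp: tm_bas tm_tens assocr_tens assms qlin simp flip: tens_bas)

lemma tm_mult:
  fixes f :: "('a::comm_monoid_add \<Rightarrow>\<^sub>0 rat) \<Rightarrow> 'c::comm_monoid_add \<Rightarrow>\<^sub>0 rat"
    and g :: "('b::comm_monoid_add \<Rightarrow>\<^sub>0 rat) \<Rightarrow> 'd::comm_monoid_add \<Rightarrow>\<^sub>0 rat"
  assumes "\<And>x y. f (x * y) = f x * f y" "\<And>x y. g (x * y) = g x * g y"
  shows "tm f g (x * y) = tm f g x * tm f g y"
  unfolding tm_def by (rule lin_mult) (auto simp: tens_mult assms simp flip: bas_mult)

lemma tm_add_right: "tm f (\<lambda>x. g x + h x) z = tm f g z + tm f h z"
  by (rule qlinear_ext[where x = z], (intro qlin)+) (auto simp: tm_bas tens_linear_right)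

text \<open>For \<open>bplus x\<close> the cocycle property produces the same three terms on both
  sides; only the term with \<open>bplus\<close> in the last factor needs the induction
  hypothesis.\<close>

lemma coassoc: "assocr (tm Delta (\<lambda>x. x) (Delta x)) = tm (\<lambda>x. x) Delta (Delta x)"
proof -
  have "assocr (tm Delta (\<lambda>x. x) (Delta (bas F))) = tm (\<lambda>x. x) Delta (Delta (bas F))" for F
  proof (induction F rule: forest_induct)
    case empty
    then show ?case
      by (simp add: Delta_one one_eq_tens tm_tens qlin assocr_tens)
  next
    case (add F G)
    then show ?case
      by (simp add: Delta_mult tm_mult assocr_mult flip: bas_mult)
  next
    case (Node F)
    define x where "x = bas F"
    have 1: "assocr (tm (\<lambda>x. x) bplus w) = tm (\<lambda>x. x) bplus2 (assocr w)" for w :: "(forest \<times> forest) \<times> forest \<Rightarrow>\<^sub>0 rat"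
      unfolding bplus2_def by (subst tm_assocr) (auto simp: qlin tm_id_fun)
    have 2: "assocr (tens (bplus2 z) 1) = tm (\<lambda>x. x) (\<lambda>y. tens (bplus y) 1) z" for z :: H2
      by (rule qlinear_ext[where x = z], (intro qlin)+)
        (auto simp: tm_bas assocr_tens simp flip: tens_bas simp: bplus2_def tm_tens qlin)
    have "assocr (tm Delta (\<lambda>x. x) (Delta (bplus x)))
        = assocr (tens (tens (bplus x) 1) 1) + assocr (tens (bplus2 (Delta x)) 1)
          + assocr (tm Delta (\<lambda>x. x) (bplus2 (Delta x)))"
      unfolding Delta_bplus by (simp add: qlinear_add[OF qlinear_tm'] qlinear_add[OF qlinear_assocr]
          tm_tens qlin Delta_bplus tens_linear_left)
    also have "tm Delta (\<lambda>x. x) (bplus2 (Delta x)) = tm (\<lambda>x. x) bplus (tm Delta (\<lambda>x. x) (Delta x))"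
      unfolding bplus2_def by (simp add: tm_comp qlin)
    also have "assocr \<dots> = tm (\<lambda>x. x) bplus2 (tm (\<lambda>x. x) Delta (Delta x))"
      unfolding 1 using Node by (simp add: x_def)
    finally have L: "assocr (tm Delta (\<lambda>x. x) (Delta (bplus x))) = tens (bplus x) (tens 1 1)
        + tm (\<lambda>x. x) (\<lambda>y. tens (bplus y) 1) (Delta x) + tm (\<lambda>x. x) (\<lambda>y. bplus2 (Delta y)) (Delta x)"
      by (simp add: 2 assocr_tens tm_comp qlin)
    have "tm (\<lambda>x. x) Delta (Delta (bplus x)) = tens (bplus x) (tens 1 1)
        + tm (\<lambda>x. x) (\<lambda>y. Delta (bplus y)) (Delta x)"
      unfolding Delta_bplus[of x] by (simp add: qlinear_add[OF qlinear_tm']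
          tm_tens qlin Delta_one one_eq_tens bplus2_def tm_comp)
    then show ?case
      using L by (simp add: x_def Delta_bplus tm_add_right)
  qed
  then show ?thesis
    by - (rule qlinear_ext[where x = x], (intro qlin qlinear_compose[OF _ qlinear_Delta])+, auto)
qed

text \<open>Applying the counit on the right is multiplicative and kills \<open>bplus2\<close>,
  whose right factors are trees and hence never empty.\<close>

lemma counit_right: "lin (\<lambda>(a, b). if b = {#} then bas a else 0) (Delta x) = x"
proof -
  define q :: "forest \<times> forest \<Rightarrow> H" where "q = (\<lambda>(a, b). if b = {#} then bas a else 0)"
  have m: "lin q (z * z') = lin q z * lin q z'" for z z'
    by (rule lin_mult) (auto simp: q_def bas_mult)
  have 0: "lin q (bplus2 z) = 0" for z
    by (rule qlinear_ext[where x = z], (intro qlin)+) (auto simp: q_def)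
  have "lin q (Delta (bas F)) = bas F" for F
  proof (induction F rule: forest_induct)
    case empty
    show ?case by (simp add: Delta_bas_empty q_def del: single_one)
  next
    case (add F G)
    then show ?case by (simp add: Delta_mult m flip: bas_mult)
  next
    case (Node F)
    then show ?case by (simp add: Delta_bas Delta_forest_tree qlinear_add[OF qlinear_lin] 0) (simp add: q_def)
  qed
  then show ?thesis
    unfolding q_def[symmetric]
    by - (rule qlinear_ext[where x = x], (intro qlin qlinear_compose[OF _ qlinear_Delta])+, auto)
qed

lemma counit_left: "lin (\<lambda>(a, b). if a = {#} then bas b else 0) (Delta x) = x"
proof -
  define q :: "forest \<times> forest \<Rightarrow> H" where "q = (\<lambda>(a, b). if a = {#} then bas b else 0)"
  have m: "lin q (z * z') = lin q z * lin q z'" for z z'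
    by (rule lin_mult) (auto simp: q_def bas_mult)
  have 0: "lin q (bplus2 z) = bplus (lin q z)" for z
    by (rule qlinear_ext[where x = z], (intro qlin qlinear_compose[OF qlinear_bplus])+)
      (auto simp: q_def qlinear_0[OF qlinear_bplus])
  have "lin q (Delta (bas F)) = bas F" for F
  proof (induction F rule: forest_induct)
    case empty
    show ?case by (simp add: Delta_bas_empty q_def del: single_one)
  next
    case (add F G)
    then show ?case by (simp add: Delta_mult m flip: bas_mult)
  next
    case (Node F)
    then show ?case
      by (simp add: Delta_bas Delta_forest_tree qlinear_add[OF qlinear_lin] 0) (simp add: q_def)
  qed
  then show ?thesis
    unfolding q_def[symmetric]
    by - (rule qlinear_ext[where x = x], (intro qlin qlinear_compose[OF _ qlinear_Delta])+, auto)
qed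

lemma coef_Delta_right: "coef (Delta x) (a, {#}) = coef x a"
proof -
  have "coef x a = coef (lin (\<lambda>(a, b). if b = {#} then bas a else 0) (Delta x)) a"
    by (simp only: counit_right)
  also have "\<dots> = (\<Sum>k\<in>Poly_Mapping.keys (Delta x). if k = (a, {#}) then coef (Delta x) k else 0)"
    unfolding lookup_lin by (intro sum.cong) (auto simp: lookup_single when_def split: prod.splits)
  also have "\<dots> = coef (Delta x) (a, {#})"
    by (simp add: sum.delta in_keys_iff)
  finally show ?thesis by simp
qed

lemma coef_Delta_left: "coef (Delta x) ({#}, b) = coef x b"
proof -
  have "coef x b = coef (lin (\<lambda>(a, b). if a = {#} then bas b else 0) (Delta x)) b"
    by (simp only: counit_left)
  also have "\<dots> = (\<Sum>k\<in>Poly_Mapping.keys (Delta x). if k = ({#}, b) then coef (Delta x) k else 0)"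
    unfolding lookup_lin by (intro sum.cong) (auto simp: lookup_single when_def split: prod.splits)
  also have "\<dots> = coef (Delta x) ({#}, b)"
    by (simp add: sum.delta in_keys_iff)
  finally show ?thesis by simp
qed

lemma fweight_simps [simp]:
  "fweight {#} = 0" "fweight (F + G) = fweight F + fweight G" "fweight {#Node F#} = Suc (fweight F)"
  by (simp_all add: fweight_def)

lemma fweight_eq_0_iff [simp]: "fweight F = 0 \<longleftrightarrow> F = {#}"
proof (cases F)
  case (add t G)
  then show ?thesis by (cases t) (simp add: fweight_def)
qed simp

text \<open>The grading serves twice: division by the weight preserves primitive elements, and the
  reduced coproduct involves smaller weights only.\<close>

lemma keys_Delta_forest:
  "Poly_Mapping.keys (Delta_forest F) \<subseteq> {(a, b). fweight a + fweight b = fweight F}"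
proof (induction F rule: forest_induct)
  case empty
  then show ?case by (simp add: Delta_forest_empty zero_prod_def)
next
  case (add F G)
  then show ?case
    using keys_mult[of "Delta_forest F" "Delta_forest G"] unfolding Delta_forest_add by fastforce
next
  case (Node F)
  have "bplus2 z = lin (\<lambda>(a, b). bas (a, {#Node b#})) z" for z
    by (simp add: bplus2_def tm_def)
  then have "Poly_Mapping.keys (bplus2 (Delta_forest F)) \<subseteq> {(a, b). fweight a + fweight b = fweight {#Node F#}}"
    using Node keys_lin[of "\<lambda>(a, b). bas (a, {#Node b#})" "Delta_forest F"] by fastforce
  then show ?case
    unfolding Delta_forest_tree
    using keys_add[of "bas ({#Node F#}, {#})" "bplus2 (Delta_forest F)"] by auto
qed

lemma mem_Prim_iff: "p \<in> Prim \<longleftrightarrow> Delta p = tens p 1 + tens 1 p"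
  by (simp add: Prim_def tensor2_eq_tens)

lemma eps_Prim: "p \<in> Prim \<Longrightarrow> coef p {#} = 0"
  using coef_Delta_left[of p "{#}"] by (simp add: mem_Prim_iff lookup_add)

subsection \<open>Grafting\<close>

definition grf :: "forest \<Rightarrow> forest \<Rightarrow> H" where
  "grf M N = sum_mset (image_mset bas (graftF M N))"

definition gr :: "forest \<Rightarrow> H \<Rightarrow> H" where
  "gr M = lin (grf M)"

lemma qlinear_gr [qlin]: "qlinear (gr M)"
  unfolding gr_def by (intro qlin)

lemma gr_bas: "gr M (bas N) = grf M N"
  by (simp add: gr_def)

text \<open>A vertex of \<open>F + G\<close> lies in exactly one of the two forests; this is the
  origin of the derivation rule \<open>gr_mult\<close>.\<close>

lemma graftF_add:
  "graftF M (F + G) = image_mset (\<lambda>N. N + G) (graftF M F) + image_mset (\<lambda>N. F + N) (graftF M G)"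
proof -
  have *: "(\<Sum>t\<in>#X. image_mset (\<lambda>t'. add_mset t' (X + Y - {#t#})) (graft t M))
      = image_mset (\<lambda>N. N + Y) (\<Sum>t\<in>#X. image_mset (\<lambda>t'. add_mset t' (X - {#t#})) (graft t M))" for X Y
  proof -
    have "image_mset (\<lambda>N. N + Y) (\<Sum>t\<in>#Z. image_mset (\<lambda>t'. add_mset t' (X - {#t#})) (graft t M))
        = (\<Sum>t\<in>#Z. image_mset (\<lambda>t'. add_mset t' (X - {#t#} + Y)) (graft t M))" for Z
      by (induction Z) (simp_all add: multiset.map_comp comp_def)
    moreover have "image_mset (\<lambda>t. image_mset (\<lambda>t'. add_mset t' (X + Y - {#t#})) (graft t M)) X
        = image_mset (\<lambda>t. image_mset (\<lambda>t'. add_mset t' (X - {#t#} + Y)) (graft t M)) X"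
      by (intro image_mset_cong) simp
    ultimately show ?thesis by simp
  qed
  show ?thesis
    unfolding graftF_def using *[of F G] *[of G F] by (simp add: add.commute)
qed

lemma sum_mset_bas_shift: "sum_mset (image_mset (\<lambda>N. bas (N + G)) X) = sum_mset (image_mset bas X) * bas G"
  for G :: "'a::comm_monoid_add"
  by (induction X) (simp_all add: distrib_right bas_mult)

lemma grf_add: "grf M (F + G) = grf M F * bas G + bas F * grf M G"
  unfolding grf_def graftF_add
  using sum_mset_bas_shift[of F "graftF M G"]
  by (simp add: multiset.map_comp comp_def sum_mset_bas_shift add.commute[of F] mult.commute[of "bas F"])

lemma graft_Node: "graft (Node cs) M = add_mset (Node (cs + M)) (image_mset Node (graftF M cs))"
proof -
  have "image_mset Node (\<Sum>t\<in>#Z. image_mset (\<lambda>t'. add_mset t' (cs - {#t#})) (graft t M))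
    = (\<Sum>t\<in>#Z. image_mset (\<lambda>t'. Node (add_mset t' (cs - {#t#}))) (graft t M))" for Z
    by (induction Z) (simp_all add: multiset.map_comp comp_def)
  then show ?thesis
    by (simp add: graftF_def multiset.map_comp comp_def)
qed

lemma grf_Node: "grf M {#Node F#} = bas {#Node (F + M)#} + bplus (grf M F)"
proof -
  have "graftF M {#Node F#} = image_mset (\<lambda>t. {#t#}) (graft (Node F) M)"
    by (simp add: graftF_def)
  then show ?thesis
    unfolding graft_Node by (simp add: grf_def multiset.map_comp comp_def qlinear_sum_mset[OF qlinear_bplus])
qed

lemma grf_empty [simp]: "grf M {#} = 0"
  by (simp add: grf_def graftF_def)

lemma gr_one [simp]: "gr M 1 = 0"
  using gr_bas[of M "{#}"] by simp

lemma gr_mult: "gr M (x * y) = gr M x * y + x * gr M y"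
proof -
  note gr_lin = qlinear_compose[OF qlinear_gr]
  have 1: "gr M (bas F * bas G) = gr M (bas F) * bas G + bas F * gr M (bas G)" for F G
    unfolding bas_mult gr_bas grf_add ..
  have 2: "gr M (bas F * y) = gr M (bas F) * y + bas F * gr M y" for F
    by (rule qlinear_ext[where x = y]) ((intro qlin gr_lin)+, rule 1)
  show ?thesis
    by (rule qlinear_ext[where x = x]) ((intro qlin gr_lin)+, rule 2)
qed

text \<open>The target vertex is either the new root, and then \<open>M\<close> joins the branches,
  or a vertex of a branch.\<close>

lemma gr_bplus: "gr M (bplus x) = bplus (bas M * x) + bplus (gr M x)"
  by (rule qlinear_ext[where x = x], (intro qlin qlinear_compose[OF qlinear_gr] qlinear_compose[OF qlinear_bplus])+)
    (simp add: gr_bas grf_Node bas_mult add.commute)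

lemma tm_derivation_left:
  fixes f :: "('a::comm_monoid_add \<Rightarrow>\<^sub>0 rat) \<Rightarrow> ('a \<Rightarrow>\<^sub>0 rat)" and z z' :: "('a \<times> 'b::comm_monoid_add) \<Rightarrow>\<^sub>0 rat"
  assumes "\<And>x y. f (x * y) = f x * y + x * f y"
  shows "tm f (\<lambda>x. x) (z * z') = tm f (\<lambda>x. x) z * z' + z * tm f (\<lambda>x. x) z'"
proof -
  have 1: "tm f (\<lambda>x. x) (bas k * bas k') = tm f (\<lambda>x. x) (bas k) * bas k' + bas k * tm f (\<lambda>x. x) (bas k')"
    for k k' :: "'a \<times> 'b"
  proof (cases k; cases k')
    fix a b a' b' assume k: "k = (a, b)" "k' = (a', b')"
    have "tm f (\<lambda>x. x) (bas k * bas k') = tens (f (bas a * bas a')) (bas b * bas b')"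
      by (simp add: k bas_mult tm_bas)
    also have "\<dots> = tens (f (bas a)) (bas b) * tens (bas a') (bas b') + tens (bas a) (bas b) * tens (f (bas a')) (bas b')"
      by (simp only: assms tens_linear_left tens_mult)
    finally show ?thesis by (simp add: k tm_bas)
  qed
  have 2: "tm f (\<lambda>x. x) (bas k * z') = tm f (\<lambda>x. x) (bas k) * z' + bas k * tm f (\<lambda>x. x) z'" for k :: "'a \<times> 'b"
    by (rule qlinear_ext[where x = z']) ((intro qlin)+, rule 1)
  show ?thesis
    by (rule qlinear_ext[where x = z]) ((intro qlin)+, rule 2)
qed

text \<open>The left factor is multiplied by a fixed \<open>c\<close> because pieces of the grafted
  forest end up on the pruned side; commutativity lets \<open>c\<close> move to either
  factor.\<close>

lemma tm_derivation_right:
  fixes g :: "('b::comm_monoid_add \<Rightarrow>\<^sub>0 rat) \<Rightarrow> ('b \<Rightarrow>\<^sub>0 rat)" and z z' :: "('a::comm_monoid_add \<times> 'b) \<Rightarrow>\<^sub>0 rat"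
  assumes "\<And>x y. g (x * y) = g x * y + x * g y"
  shows "tm (\<lambda>x. c * x) g (z * z') = tm (\<lambda>x. c * x) g z * z' + z * tm (\<lambda>x. c * x) g z'"
proof -
  let ?T = "tm (\<lambda>x. c * x) g"
  have 1: "?T (bas k * bas k') = ?T (bas k) * bas k' + bas k * ?T (bas k')"
    for k k' :: "'a \<times> 'b"
  proof (cases k; cases k')
    fix a b a' b' assume k: "k = (a, b)" "k' = (a', b')"
    have "?T (bas k * bas k') = tens (c * (bas a * bas a')) (g (bas b * bas b'))"
      by (simp add: k bas_mult tm_bas)
    also have "\<dots> = tens (c * bas a) (g (bas b)) * tens (bas a') (bas b') + tens (bas a) (bas b) * tens (c * bas a') (g (bas b'))"
      by (simp only: assms tens_linear_right tens_mult) (simp add: mult_ac)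
    finally show ?thesis by (simp add: k tm_bas)
  qed
  have 2: "?T (bas k * z') = ?T (bas k) * z' + bas k * ?T z'" for k :: "'a \<times> 'b"
    by (rule qlinear_ext[where x = z']) ((intro qlin)+, rule 1)
  show ?thesis
    by (rule qlinear_ext[where x = z]) ((intro qlin)+, rule 2)
qed

text \<open>\<open>gr_cut z\<close> is the part of the coproduct of a grafting in which the grafted forest,
  with coproduct \<open>z\<close>, meets the root side of the cut.\<close>
definition gr_cut :: "H2 \<Rightarrow> H2 \<Rightarrow> H2" where
  "gr_cut z w = lin (\<lambda>(m, m'). tm (\<lambda>x. bas m * x) (gr m') w) z"

lemma qlinear_gr_cut_right [qlin]: "qlinear f \<Longrightarrow> qlinear (\<lambda>w. gr_cut z (f w))"
  unfolding gr_cut_def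
proof (rule qlinear_lin_fun)
  fix k :: "forest \<times> forest" assume "qlinear f"
  then show "qlinear (\<lambda>x. case k of (m, m') \<Rightarrow> tm (\<lambda>x. bas m * x) (gr m') (f x))"
    by (cases k) (simp add: qlin)
qed

lemma qlinear_gr_cut_left [qlin]: "qlinear f \<Longrightarrow> qlinear (\<lambda>z. gr_cut (f z) w)"
  unfolding gr_cut_def by (intro qlin)

lemma gr_cut_mult: "gr_cut z (w * w') = gr_cut z w * w' + w * gr_cut z w'"
  by (rule qlinear_ext[where x = z], (intro qlin)+)
    (auto simp: gr_cut_def tm_derivation_right gr_mult)

lemma gr_cut_bplus2: "gr_cut z (bplus2 w) = bplus2 (z * w) + bplus2 (gr_cut z w)"
proof -
  have 1: "gr_cut (bas k) (bplus2 (bas l)) = bplus2 (bas k * bas l) + bplus2 (gr_cut (bas k) (bas l))" for k l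
  proof (cases k; cases l)
    fix m m' a b assume k: "k = (m, m')" "l = (a, b)"
    have "gr_cut (bas k) (bplus2 (bas l)) = tens (bas m * bas a) (gr m' (bplus (bas b)))"
      by (simp add: gr_cut_def k tm_bas)
    also have "\<dots> = tens (bas m * bas a) (bplus (bas m' * bas b)) + tens (bas m * bas a) (bplus (gr m' (bas b)))"
      by (simp only: gr_bplus tens_linear_right)
    also have "\<dots> = bplus2 (bas k * bas l) + bplus2 (gr_cut (bas k) (bas l))"
      unfolding k gr_cut_def by (simp add: bas_mult tm_bas) (simp add: bplus2_def tm_tens qlin)
    finally show ?thesis .
  qed
  have 2: "gr_cut (bas k) (bplus2 w) = bplus2 (bas k * w) + bplus2 (gr_cut (bas k) w)" for k
    by (rule qlinear_ext[where x = w]) ((intro qlin)+, rule 1)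
  show ?thesis
    by (rule qlinear_ext[where x = z]) ((intro qlin)+, rule 2)
qed

lemma gr_cut_tens_one: "gr_cut z (tens x 1) = 0"
  by (rule qlinear_ext[where x = z], (intro qlin)+)
    (auto simp: gr_cut_def tm_tens qlin tens_linear_right)

text \<open>Relative to a cut the target vertex has two possible places. On the pruned side it takes
  all of \<open>M\<close> with it, which is the first term; on the root side \<open>M\<close> is cut
  as well, which is \<open>gr_cut\<close>.\<close>

lemma Delta_gr: "Delta (gr M y) = tm (gr M) (\<lambda>x. x) (Delta y) + gr_cut (Delta_forest M) (Delta y)"
proof -
  have "Delta (gr M (bas N)) = tm (gr M) (\<lambda>x. x) (Delta (bas N)) + gr_cut (Delta_forest M) (Delta (bas N))" for N
  proof (induction N rule: forest_induct)
    case empty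
    then show ?case
      by (simp add: Delta_one one_eq_tens tm_tens qlin gr_cut_tens_one tens_linear_left qlinear_0[OF qlinear_Delta])
  next
    case (add F G)
    then show ?case
      unfolding bas_mult[symmetric]
      by (simp add: Delta_mult gr_mult tm_derivation_left gr_cut_mult qlinear_add[OF qlinear_Delta] algebra_simps)
  next
    case (Node F)
    define x where "x = bas F"
    have "tm (gr M) (\<lambda>x. x) (bplus2 z) = bplus2 (tm (gr M) (\<lambda>x. x) z)" for z
      unfolding bplus2_def by (simp add: tm_comp qlin)
    then have "tm (gr M) (\<lambda>x. x) (Delta (bplus x)) + gr_cut (Delta_forest M) (Delta (bplus x))
        = tens (gr M (bplus x)) 1 + bplus2 (Delta_forest M * Delta x)
          + bplus2 (tm (gr M) (\<lambda>x. x) (Delta x) + gr_cut (Delta_forest M) (Delta x))"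
      unfolding Delta_bplus
      by (simp add: qlinear_add[OF qlinear_tm'] qlinear_add[OF qlinear_gr_cut_right[OF qlinear_ident]]
         tm_tens qlin gr_cut_tens_one gr_cut_bplus2 qlinear_add[OF qlinear_bplus2'])
    also have "\<dots> = tens (gr M (bplus x)) 1 + bplus2 (Delta (bas M * x)) + bplus2 (Delta (gr M x))"
      using Node by (simp add: x_def Delta_mult Delta_bas)
    also have "\<dots> = Delta (gr M (bplus x))"
      by (simp add: gr_bplus Delta_bplus qlinear_add[OF qlinear_Delta] tens_linear_left)
    finally show ?case by (simp add: x_def)
  qed
  then show ?thesis
    by - (rule qlinear_ext[where x = y], (intro qlin qlinear_compose[OF _ qlinear_Delta]
        qlinear_compose[OF qlinear_Delta])+, auto)
qed

text \<open>The normalisation as a map of its own. At the empty forest the factor is 1 / 0 = 0, in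
  accordance with M \<top> 1 = 0.\<close>

definition wdiv :: "H \<Rightarrow> H" where
  "wdiv = lin (\<lambda>N. sc (1 / of_nat (fweight N)) (bas N))"

lemma qlinear_wdiv [qlin]: "qlinear wdiv"
  unfolding wdiv_def by (intro qlin)

lemma top_eq: "top x y = lin (\<lambda>M. gr M (wdiv y)) x"
proof -
  have "topF M N = gr M (wdiv (bas N))" for M N
    by (cases "N = {#}") (simp_all add: topF_def wdiv_def qlinear_sc[OF qlinear_gr] gr_bas grf_def qlinear_0[OF qlinear_gr] del: single_one)
  then have "gr M (wdiv y) = (\<Sum>N\<in>Poly_Mapping.keys y. sc (coef y N) (topF M N))" for M
    using lin_qlinear[OF qlinear_compose[OF qlinear_gr qlinear_wdiv], of M y] by (simp add: lin_def)
  then show ?thesis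
    by (simp add: top_def lin_def pm.scale_sum_right)
qed

lemma qlinear_top_left [qlin]: "qlinear f \<Longrightarrow> qlinear (\<lambda>x. top (f x) y)"
  unfolding top_eq by (intro qlin)

lemma qlinear_top_right [qlin]: "qlinear f \<Longrightarrow> qlinear (\<lambda>x. top y (f x))"
  unfolding top_eq by (intro qlin qlinear_compose[OF qlinear_gr] qlinear_compose[OF qlinear_wdiv])

text \<open>By the grading, the coproduct turns division by the weight into division by the total
  weight of both factors, and on p \<otimes> 1 and 1 \<otimes> p the total weight is the weight of
  p.\<close>

lemma wdiv_Prim:
  assumes "p \<in> Prim"
  shows "wdiv p \<in> Prim"
proof -
  define w2 :: "H2 \<Rightarrow> H2" where
    "w2 = lin (\<lambda>(a, b). sc (1 / of_nat (fweight a + fweight b)) (bas (a, b)))"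
  have w2: "qlinear w2" unfolding w2_def by (intro qlin)
  have "w2 (Delta (bas F)) = Delta (wdiv (bas F))" for F
  proof -
    have "w2 (Delta_forest F) = sc (1 / of_nat (fweight F)) (Delta_forest F)"
    proof (rule qlinear_ext_on[of w2 "sc (1 / of_nat (fweight F))"])
      fix k assume "k \<in> Poly_Mapping.keys (Delta_forest F)"
      then show "w2 (bas k) = sc (1 / of_nat (fweight F)) (bas k)"
        using keys_Delta_forest[of F] by (auto simp: w2_def simp flip: of_nat_add)
    qed (intro w2 qlin)+
    then show ?thesis
      by (simp add: Delta_bas wdiv_def qlinear_sc[OF qlinear_Delta])
  qed
  then have "Delta (wdiv p) = w2 (Delta p)"
    by - (rule qlinear_ext[where x = p], (intro qlinear_compose[OF w2 qlinear_Delta]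
        qlinear_compose[OF qlinear_Delta qlinear_wdiv])+, auto)
  moreover have "w2 (tens x 1) = tens (wdiv x) 1" for x
    by (rule qlinear_ext[where x = x], (intro qlin qlinear_compose[OF w2] qlinear_wdiv)+)
      (auto simp: w2_def wdiv_def tens_linear_left simp flip: single_one)
  moreover have "w2 (tens 1 x) = tens 1 (wdiv x)" for x
    by (rule qlinear_ext[where x = x], (intro qlin qlinear_compose[OF w2] qlinear_wdiv)+)
      (auto simp: w2_def wdiv_def tens_linear_right simp flip: single_one)
  ultimately show ?thesis
    using assms by (simp add: mem_Prim_iff qlinear_add[OF w2])
qed

text \<open>Grafting onto 1 gives 0, so for primitive \<open>p\<close> most terms of
  \<open>Delta_gr\<close> vanish. What remains beside the first term is a cut of \<open>x\<close>
  whose root part is grafted onto \<open>p\<close>.\<close>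

lemma Delta_top:
  assumes "p \<in> Prim"
  shows "Delta (top x p) = tens (top x p) 1 + tm (\<lambda>y. y) (\<lambda>y. top y p) (Delta x)"
proof -
  define q where "q = wdiv p"
  have q: "Delta q = tens q 1 + tens 1 q"
    using wdiv_Prim[OF assms] by (simp add: mem_Prim_iff q_def)
  have cut: "gr_cut z (tens 1 q) = tm (\<lambda>y. y) (\<lambda>y. top y p) z" for z
    by (rule qlinear_ext[where x = z], (intro qlin)+)
      (auto simp: gr_cut_def tm_bas tm_tens qlin top_eq q_def)
  have "Delta (top (bas M) p) = tens (top (bas M) p) 1 + tm (\<lambda>y. y) (\<lambda>y. top y p) (Delta (bas M))" for M
    using Delta_gr[of M q]
    by (simp add: q qlinear_add[OF qlinear_tm'] qlinear_add[OF qlinear_gr_cut_right[OF qlinear_ident]]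
        tm_tens qlin gr_cut_tens_one cut tens_linear_left Delta_bas) (simp add: top_eq q_def)
  then show ?thesis
    by - (rule qlinear_ext[where x = x], (intro qlin qlinear_compose[OF qlinear_Delta]
        qlinear_compose[OF _ qlinear_Delta])+, auto)
qed

lemma grf_unit: "grf {#} N = sc (of_nat (fweight N)) (bas N)"
proof (induction N rule: forest_induct)
  case (add F G)
  then show ?case by (simp add: grf_add sc_mult_left sc_mult_right bas_mult pm.scale_left_distrib)
next
  case (Node F)
  then show ?case by (simp add: grf_Node qlinear_sc[OF qlinear_bplus] pm.scale_left_distrib)
qed simp

text \<open>Grafting the empty forest onto every vertex multiplies a forest by its weight, which the
  normalisation cancels. A constant term would be sent to 0.\<close>

lemma top_one_left:
  assumes "coef p {#} = 0"
  shows "top 1 p = p"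
proof -
  have "top 1 p = gr {#} (wdiv p)"
    using lin_bas[of "\<lambda>M. gr M (wdiv p)" "{#}"] by (simp add: top_eq)
  also have "\<dots> = p"
  proof (rule qlinear_ext_on[where x = p and g = "\<lambda>x. x"])
    fix N assume "N \<in> Poly_Mapping.keys p"
    then have "N \<noteq> {#}" using assms by auto
    then show "gr {#} (wdiv (bas N)) = bas N"
      by (simp add: wdiv_def qlinear_sc[OF qlinear_gr] gr_bas grf_unit)
  qed (intro qlin qlinear_compose[OF qlinear_gr qlinear_wdiv])+
  finally show ?thesis .
qed

lemma coef_top_empty: "coef (top x y) {#} = 0"
proof -
  have "coef (sum_mset (image_mset bas X)) {#} = 0" if "{#} \<notin># X" for X :: "forest multiset"
    using that by (induction X) (auto simp: lookup_add lookup_single)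
  moreover have "{#} \<notin># graftF M N" for M N
    by (auto simp: graftF_def)
  ultimately have "coef (gr M z) {#} = 0" for M z
    by (simp add: gr_def lookup_lin grf_def)
  then show ?thesis
    by (simp add: top_eq lookup_lin)
qed

subsection \<open>Iterated grafting of primitive elements\<close>

lemma Fmap_eq_lin: "Fmap = lin Fl"
  by (rule ext) (simp add: Fmap_def lin_def)

lemma qlinear_Fmap [qlin]: "qlinear Fmap"
  unfolding Fmap_eq_lin by (intro qlin)

lemma lift_eq_lin: "lift = lin (\<lambda>f. bas [f])"
  by (rule ext) (simp add: lift_def lin_def sc_single)

lemma qlinear_lift [qlin]: "qlinear lift"
  unfolding lift_eq_lin by (intro qlin)

lemma tensT_eq_lin: "tensT a b = lin (\<lambda>l. lin (\<lambda>m. bas (l @ m)) b) a"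
  unfolding tensT_def lin_def by (simp add: pm.scale_sum_right single_eq_sc_bas[of _ "_ * _"])

lemma qlinear_tensT_left [qlin]: "qlinear f \<Longrightarrow> qlinear (\<lambda>x. tensT (f x) b)"
  unfolding tensT_eq_lin by (intro qlin)

lemma qlinear_tensT_right [qlin]: "qlinear f \<Longrightarrow> qlinear (\<lambda>x. tensT a (f x))"
  unfolding tensT_eq_lin by (intro qlin)

lemma tensT_bas [simp]: "tensT (bas l) (bas m) = bas (l @ m)"
  by (simp add: tensT_eq_lin)

lemma tensT_Nil_left [simp]: "tensT (bas []) b = b"
  by (rule qlinear_ext[where x = b], (intro qlin)+) simp

lemma tensT_Nil_right [simp]: "tensT a (bas []) = a"
  by (rule qlinear_ext[where x = a], (intro qlin)+) simp

lemma tensT_assoc: "tensT (tensT a b) c = tensT a (tensT b c)"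
proof -
  have 3: "tensT (tensT (bas k) (bas l)) (bas m) = tensT (bas k) (tensT (bas l) (bas m))" for k l m
    by simp
  have 2: "tensT (tensT (bas k) (bas l)) c = tensT (bas k) (tensT (bas l) c)" for k l
    by (rule qlinear_ext[where x = c]) ((intro qlin)+, rule 3)
  have 1: "tensT (tensT (bas k) b) c = tensT (bas k) (tensT b c)" for k
    by (rule qlinear_ext[where x = b]) ((intro qlin)+, rule 2)
  show ?thesis
    by (rule qlinear_ext[where x = a]) ((intro qlin)+, rule 1)
qed

lemma ptens_append: "ptens (v @ w) = tensT (ptens v) (ptens w)"
  by (induction v) (simp_all add: tensT_assoc)

lemma keys_tensT: "Poly_Mapping.keys (tensT a b)
    \<subseteq> {l @ m |l m. l \<in> Poly_Mapping.keys a \<and> m \<in> Poly_Mapping.keys b}"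
proof
  fix k assume "k \<in> Poly_Mapping.keys (tensT a b)"
  then obtain l where l: "l \<in> Poly_Mapping.keys a" "k \<in> Poly_Mapping.keys (lin (\<lambda>m. bas (l @ m)) b)"
    using keys_lin[of "\<lambda>l. lin (\<lambda>m. bas (l @ m)) b" a] unfolding tensT_eq_lin by blast
  from subsetD[OF keys_lin l(2)] obtain m where "m \<in> Poly_Mapping.keys b" "k = l @ m" by auto
  then show "k \<in> {l @ m |l m. l \<in> Poly_Mapping.keys a \<and> m \<in> Poly_Mapping.keys b}"
    using l(1) by blast
qed

lemma keys_lift: "Poly_Mapping.keys (lift h) \<subseteq> {l. length l = 1}"
  using keys_lin[of "\<lambda>f. bas [f]" h] unfolding lift_eq_lin by auto

lemma keys_ptens: "Poly_Mapping.keys (ptens w) \<subseteq> {l. length l = length w}"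
proof (induction w)
  case (Cons h w)
  show ?case
  proof
    fix l assume "l \<in> Poly_Mapping.keys (ptens (h # w))"
    then obtain k m where "l = k @ m" "k \<in> Poly_Mapping.keys (lift h)" "m \<in> Poly_Mapping.keys (ptens w)"
      using keys_tensT[of "lift h" "ptens w"] by auto
    then show "l \<in> {l. length l = length (h # w)}"
      using subsetD[OF keys_lift, of k h] subsetD[OF Cons, of m] by simp
  qed
qed simp

definition wF :: "H list \<Rightarrow> H" where
  "wF w = Fmap (ptens w)"

lemma wF_Nil [simp]: "wF [] = 1"
  by (simp add: wF_def Fmap_eq_lin)

lemma Fmap_lift: "Fmap (lift h) = h"
  by (rule qlinear_ext[where x = h], (intro qlin qlinear_compose[OF qlinear_Fmap])+)
    (simp add: lift_eq_lin Fmap_eq_lin)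

lemma wF_single [simp]: "wF [h] = h"
  by (simp add: wF_def Fmap_lift)

text \<open>\<open>Fl\<close> starts its fold at the first letter and not at 1, hence the exclusion
  of the empty list; \<open>wF_snoc\<close> covers that case through 1 \<top> p = p.\<close>

lemma Fmap_tensT_lift:
  assumes "[] \<notin> Poly_Mapping.keys a"
  shows "Fmap (tensT a (lift h)) = top (Fmap a) h"
proof (rule qlinear_ext_on[where x = a and f = "\<lambda>a. Fmap (tensT a (lift h))"])
  fix l assume "l \<in> Poly_Mapping.keys a"
  then obtain f l' where l: "l = f # l'" using assms by (cases l) auto
  have "Fmap (tensT (bas l) (lift (bas m))) = top (Fmap (bas l)) (bas m)" for m
    by (simp add: lift_eq_lin Fmap_eq_lin l)
  then show "Fmap (tensT (bas l) (lift h)) = top (Fmap (bas l)) h"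
    by - (rule qlinear_ext[where x = h],
      (intro qlin qlinear_compose[OF qlinear_Fmap] qlinear_compose[OF qlinear_lift])+, auto)
qed (intro qlin qlinear_compose[OF qlinear_Fmap])+

lemma wF_snoc: "p \<in> Prim \<Longrightarrow> wF (w @ [p]) = top (wF w) p"
proof (cases "w = []")
  case True
  assume "p \<in> Prim"
  then show ?thesis using True by (simp add: top_one_left eps_Prim)
next
  case False
  then have "[] \<notin> Poly_Mapping.keys (ptens w)" using keys_ptens[of w] by fastforce
  then show ?thesis by (simp add: wF_def ptens_append Fmap_tensT_lift)
qed

lemma Delta_wF:
  assumes "set w \<subseteq> Prim"
  shows "Delta (wF w) = (\<Sum>i\<le>length w. tens (wF (take i w)) (wF (drop i w)))"
  using assms
proof (induction w rule: rev_induct)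
  case Nil
  then show ?case by (simp add: Delta_one flip: one_eq_tens)
next
  case (snoc p w)
  then have p: "p \<in> Prim" and IH: "Delta (wF w) = (\<Sum>i\<le>length w. tens (wF (take i w)) (wF (drop i w)))"
    by auto
  have "Delta (wF (w @ [p])) = tens (wF (w @ [p])) 1
      + (\<Sum>i\<le>length w. tens (wF (take i w)) (top (wF (drop i w)) p))"
    unfolding wF_snoc[OF p] Delta_top[OF p] IH
    by (simp add: qlinear_sum[OF qlinear_tm'] tm_tens qlin)
  also have "(\<Sum>i\<le>length w. tens (wF (take i w)) (top (wF (drop i w)) p))
      = (\<Sum>i\<le>length w. tens (wF (take i (w @ [p]))) (wF (drop i (w @ [p]))))"
    by (intro sum.cong) (auto simp: wF_snoc[OF p])
  finally show ?case by simp
qed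

lemma coef_wF_empty: "set w \<subseteq> Prim \<Longrightarrow> coef (wF w) {#} = (if w = [] then 1 else 0)"
  by (induction w rule: rev_induct) (auto simp: wF_snoc coef_top_empty)

text \<open>Letters are formal here: the source is free on words whose letters are elements of H, so
  coefficients of words make sense before their images are known to be independent.\<close>

definition WF :: "(H list \<Rightarrow>\<^sub>0 rat) \<Rightarrow> H" where
  "WF = lin wF"

lemma qlinear_WF [qlin]: "qlinear WF"
  unfolding WF_def by (intro qlin)

lemma WF_bas [simp]: "WF (bas w) = wF w"
  by (simp add: WF_def)

definition dec :: "('a list \<Rightarrow>\<^sub>0 rat) \<Rightarrow> ('a list \<times> 'a list \<Rightarrow>\<^sub>0 rat)" where
  "dec = lin (\<lambda>w. \<Sum>i\<le>length w. bas (take i w, drop i w))"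

lemma qlinear_dec [qlin]: "qlinear dec"
  unfolding dec_def by (intro qlin)

lemma dec_bas: "dec (bas w) = (\<Sum>i\<le>length w. bas (take i w, drop i w))"
  by (simp add: dec_def)

text \<open>At most one prefix of \<open>w\<close> equals \<open>u\<close>, namely the one of length
  \<open>length u\<close>; if \<open>w\<close> is shorter than \<open>u\<close>, both sides
  vanish.\<close>

lemma sum_take_drop:
  "(\<Sum>i\<le>length w. if take i w = u then g (drop i w) else 0)
    = (if take (length u) w = u then g (drop (length u) w) else (0::'b::comm_monoid_add))"
proof -
  have "(\<Sum>i\<le>length w. if take i w = u then g (drop i w) else 0)
      = (\<Sum>i\<le>length w. if i = length u then (if take (length u) w = u then g (drop (length u) w) else 0) else 0)"
  proof (intro sum.cong refl)
    fix i assume "i \<in> {..length w}"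
    then have "take i w = u \<longleftrightarrow> i = length u \<and> take (length u) w = u" by auto
    then show "(if take i w = u then g (drop i w) else 0)
        = (if i = length u then (if take (length u) w = u then g (drop (length u) w) else 0) else 0)"
      by auto
  qed
  also have "\<dots> = (if take (length u) w = u then g (drop (length u) w) else 0)"
    by (auto simp: sum.delta)
  finally show ?thesis .
qed

text \<open>Deconcatenation is dual to concatenation. In this form coassociativity becomes an
  equation between coefficients.\<close>

lemma lookup_dec: "coef (dec y) (u, v) = coef y (u @ v)"
proof -
  have *: "coef (dec (bas w)) (u, v) = (if w = u @ v then 1 else 0)" for w :: "'a list"
  proof -
    have "coef (dec (bas w)) (u, v) = (\<Sum>i\<le>length w. if take i w = u then (if drop i w = v then 1 else 0) else 0)"
      by (simp add: dec_bas lookup_sum lookup_single when_def cong: if_cong sum.cong) (meson)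
    also have "\<dots> = (if w = u @ v then 1 else 0)"
      unfolding sum_take_drop[where g = "\<lambda>z. if z = v then 1 else 0"] by (metis append_eq_conv_conj append_take_drop_id)
    finally show ?thesis .
  qed
  have "coef (dec y) (u, v) = (\<Sum>w\<in>Poly_Mapping.keys y. coef y w * coef (dec (bas w)) (u, v))"
    by (simp only: dec_def lookup_lin lin_bas)
  then have "coef (dec y) (u, v) = (\<Sum>w\<in>Poly_Mapping.keys y. if w = u @ v then coef y w else 0)"
    unfolding * by (simp add: if_distrib cong: if_cong)
  then show ?thesis
    by (simp add: sum.delta in_keys_iff)
qed

lemma lookup_tm_dec_left: "coef (tm dec (\<lambda>x. x) z) ((u, v), w) = coef z (u @ v, w)"
proof -
  have "coef (tm dec (\<lambda>x. x) z) ((u, v), w) = (\<Sum>k\<in>Poly_Mapping.keys z. if k = (u @ v, w) then coef z k else 0)"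
    unfolding tm_def lookup_lin
    by (intro sum.cong) (auto simp: lookup_dec lookup_single when_def split: prod.splits)
  then show ?thesis by (simp add: sum.delta in_keys_iff)
qed

lemma lookup_tm_dec_right: "coef (tm (\<lambda>x. x) dec z) (u, v, w) = coef z (u, v @ w)"
proof -
  have "coef (tm (\<lambda>x. x) dec z) (u, v, w) = (\<Sum>k\<in>Poly_Mapping.keys z. if k = (u, v @ w) then coef z k else 0)"
    unfolding tm_def lookup_lin
    by (intro sum.cong) (auto simp: lookup_dec lookup_single when_def split: prod.splits)
  then show ?thesis by (simp add: sum.delta in_keys_iff)
qed

lemma Delta_WF:
  assumes "Poly_Mapping.keys y \<subseteq> lists Prim"
  shows "Delta (WF y) = tm WF WF (dec y)"
proof (rule qlinear_ext_on[where x = y and f = "\<lambda>y. Delta (WF y)"])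
  fix w assume "w \<in> Poly_Mapping.keys y"
  then have "set w \<subseteq> Prim" using assms by auto
  then show "Delta (WF (bas w)) = tm WF WF (dec (bas w))"
    by (simp add: Delta_wF dec_bas qlinear_sum[OF qlinear_tm'] tm_bas)
qed (intro qlin qlinear_compose[OF qlinear_Delta] qlinear_dec)+

lemma coef_WF_empty:
  assumes "Poly_Mapping.keys y \<subseteq> lists Prim"
  shows "coef (WF y) {#} = coef y []"
proof -
  have "coef (WF y) {#} = (\<Sum>w\<in>Poly_Mapping.keys y. if w = [] then coef y w else 0)"
    unfolding WF_def lookup_lin
  proof (intro sum.cong refl)
    fix w assume "w \<in> Poly_Mapping.keys y"
    then have "set w \<subseteq> Prim" using assms by auto
    then show "coef y w * coef (wF w) {#} = (if w = [] then coef y w else 0)"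
      by (simp add: coef_wF_empty)
  qed
  then show ?thesis by (simp add: sum.delta in_keys_iff)
qed

lemma subspace_Prim: "pm.subspace Prim"
  by (auto simp: pm.subspace_def mem_Prim_iff qlinear_0[OF qlinear_Delta] qlinear_add[OF qlinear_Delta]
      qlinear_sc[OF qlinear_Delta] tens_linear_left tens_linear_right pm.scale_right_distrib)

subsection \<open>Words over a basis of the primitive elements form a basis\<close>

locale prim_basis =
  fixes B :: "H set"
  assumes B_Prim: "B \<subseteq> Prim" and indep_B: "pm.independent B" and Prim_span: "Prim \<subseteq> pm.span B"
begin

lemma lists_B: "w \<in> lists B \<Longrightarrow> set w \<subseteq> Prim"
  using B_Prim by auto

lemma lists_B_Prim: "lists B \<subseteq> lists Prim"
  using B_Prim by (rule lists_mono)

text \<open>Only 1 and the letters are prescribed, which is possible since 1 is not primitive and so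
  lies outside the span of \<open>B\<close>. Values on longer words stay unknown.\<close>

lemma ex_letter_projection: "\<exists>P :: H \<Rightarrow> H \<Rightarrow>\<^sub>0 rat. qlinear P \<and> P 1 = 0 \<and> (\<forall>b\<in>B. P b = bas b)"
proof -
  have "(1 :: H) \<notin> Prim"
    using eps_Prim[of 1] by auto
  moreover have "pm.span B \<subseteq> Prim"
    by (rule pm.span_minimal[OF B_Prim subspace_Prim])
  ultimately have 1: "1 \<notin> pm.span B" by blast
  then have "pm.independent (insert 1 B)"
    by (simp add: pm.independent_insert indep_B)
  then obtain P :: "H \<Rightarrow> H \<Rightarrow>\<^sub>0 rat" where P: "Vector_Spaces.linear sc sc P"
    "\<forall>b\<in>insert 1 B. P b = (if b = 1 then 0 else bas b)"
    using pmp.linear_independent_extend[of "insert 1 B" "\<lambda>b. if b = 1 then 0 else bas b"] by blast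
  moreover have "1 \<notin> B" using 1 pm.span_base by blast
  ultimately show ?thesis
    by (metis insertI1 insertI2 qlinear_iff_linear)
qed

text \<open>Applying id \<otimes> P to the coproduct and reading off a letter \<open>b\<close> in
  the second factor shortens every word, so the induction hypothesis applies. Behind a prefix of the
  maximal length \<open>n\<close> at most one letter is left, and there \<open>P\<close> is
  known.\<close>

lemma WF_kernel_bounded:
  assumes "Poly_Mapping.keys y \<subseteq> lists B" "\<And>w. w \<in> Poly_Mapping.keys y \<Longrightarrow> length w \<le> n" "WF y = 0"
  shows "y = 0"
  using assms
proof (induction n arbitrary: y)
  case 0
  then have "Poly_Mapping.keys y \<subseteq> {[]}" by auto
  moreover have "coef y [] = 0"
    using coef_WF_empty[of y] 0 lists_B_Prim by auto
  ultimately show ?case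
    by (intro poly_mapping_eqI) (metis in_keys_iff lookup_zero singletonD subsetD)
next
  case (Suc n)
  obtain P :: "H \<Rightarrow> H \<Rightarrow>\<^sub>0 rat" where P: "qlinear P" "P 1 = 0" "\<And>b. b \<in> B \<Longrightarrow> P b = bas b"
    using ex_letter_projection by blast
  have "coef y (u @ [b]) = 0" if b: "b \<in> B" and u: "length u = n" for u b
  proof -
    define g where "g = (\<lambda>w. \<Sum>i\<le>length w. sc (coef (P (wF (drop i w))) b) (bas (take i w)))"
    define y' where "y' = lin g y"
    define sl :: "(forest \<times> H \<Rightarrow>\<^sub>0 rat) \<Rightarrow> H" where "sl = lin (\<lambda>(a, c). if c = b then bas a else 0)"
    have sl: "qlinear sl" unfolding sl_def by (intro qlin)
    have sl_tens: "sl (tens x z) = sc (coef z b) x" for x z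
    proof -
      have "sl (tens (bas a) z) = sc (coef z b) (bas a)" for a
      proof -
        have "tens (bas a) z = lin (\<lambda>c. bas (a, c)) z" by (simp add: tens_def)
        moreover have "sl (lin (\<lambda>c. bas (a, c)) z) = lin (\<lambda>c. if c = b then bas a else 0) z"
          by (rule qlinear_ext[where x = z], (intro qlin qlinear_compose[OF sl])+) (simp add: sl_def)
        moreover have "lin (\<lambda>c. if c = b then bas a else 0) z = sc (coef z b) (bas a)"
          by (simp add: lin_def sum.delta in_keys_iff if_distrib cong: if_cong)
        ultimately show ?thesis by simp
      qed
      then show ?thesis
        by - (rule qlinear_ext[where x = x], (intro qlin qlinear_compose[OF sl])+, auto)
    qed
    have "WF y' = sl (tm (\<lambda>x. x) P (Delta (WF y)))"
      unfolding y'_def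
    proof (rule qlinear_ext_on[where x = y and f = "\<lambda>y. WF (lin g y)"])
      fix w assume "w \<in> Poly_Mapping.keys y"
      then have w: "set w \<subseteq> Prim" using Suc.prems lists_B by blast
      show "WF (lin g (bas w)) = sl (tm (\<lambda>x. x) P (Delta (WF (bas w))))"
        by (simp add: Delta_wF[OF w] g_def qlinear_sum[OF qlinear_WF] qlinear_sum[OF qlinear_tm']
            qlinear_sum[OF sl] qlinear_sc[OF qlinear_WF] tm_tens qlin P(1) sl_tens)
    qed (intro qlin qlinear_compose[OF qlinear_WF] qlinear_compose[OF sl] qlinear_compose[OF qlinear_Delta])+
    then have WFy': "WF y' = 0"
      using Suc.prems by (simp add: qlinear_0[OF qlinear_Delta] qlinear_0[OF qlinear_tm'] qlinear_0[OF sl])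
    have coef_g: "coef (g w) v = (if take (length v) w = v then coef (P (wF (drop (length v) w))) b else 0)" for w v
      unfolding g_def using sum_take_drop[where u = v and w = w and g = "\<lambda>z. coef (P (wF z)) b"]
      by (simp add: lookup_sum lookup_single when_def if_distrib cong: if_cong)
    have "Poly_Mapping.keys y' \<subseteq> lists B"
    proof -
      have "Poly_Mapping.keys (g w) \<subseteq> lists B" if "w \<in> lists B" for w
      proof
        fix v assume "v \<in> Poly_Mapping.keys (g w)"
        then have "v = take (length v) w" by (auto simp: coef_g in_keys_iff split: if_splits)
        then show "v \<in> lists B" using that by (metis append_in_lists_conv append_take_drop_id)
      qed
      then show ?thesis
        unfolding y'_def using keys_lin[of g y] Suc.prems(1) by blast
    qed
    moreover have "length v \<le> n" if v: "v \<in> Poly_Mapping.keys y'" for v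
    proof -
      obtain w where w: "w \<in> Poly_Mapping.keys y" and "v \<in> Poly_Mapping.keys (g w)"
        using v keys_lin[of g y] unfolding y'_def by blast
      then have "coef (g w) v \<noteq> 0" by (simp add: in_keys_iff)
      \<comment> \<open>\<open>P 1 = 0\<close> rules out the empty tail, so the prefix
        \<open>v\<close> is strictly shorter than \<open>w\<close>.\<close>
      then have "take (length v) w = v" "wF (drop (length v) w) \<noteq> 1"
        using P(2) by (auto simp: coef_g split: if_splits)
      then have "length v < length w" by (metis drop_all not_le wF_Nil)
      then show ?thesis using Suc.prems(2)[OF w] by simp
    qed
    ultimately have "y' = 0"
      using WFy' by (intro Suc.IH) auto
    moreover have "coef y' u = (\<Sum>w\<in>Poly_Mapping.keys y. if w = u @ [b] then coef y w else 0)"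
      unfolding y'_def lookup_lin
    proof (intro sum.cong refl)
      fix w assume w: "w \<in> Poly_Mapping.keys y"
      have "coef (g w) u = (if w = u @ [b] then 1 else 0)"
      proof (cases "take n w = u")
        case True
        define v where "v = drop n w"
        have wv: "w = u @ v" using True v_def by (metis append_take_drop_id)
        then have "length v \<le> 1" using Suc.prems(2)[OF w] u by simp
        then consider "v = []" | c where "v = [c]"
          by (cases v) auto
        then show ?thesis
        proof cases
          case 1
          then show ?thesis using wv u P(2) by (simp add: coef_g)
        next
          case (2 c)
          then have "c \<in> B" using wv w Suc.prems(1) by auto
          then show ?thesis using wv u 2 P(3) by (auto simp: coef_g lookup_single when_def)
        qed
      next
        case False
        then show ?thesis using u by (auto simp: coef_g)
      qed
      then show "coef y w * coef (g w) u = (if w = u @ [b] then coef y w else 0)" by simp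
    qed
    ultimately show ?thesis by (simp add: sum.delta in_keys_iff split: if_splits)
  qed
  then have "length w \<noteq> Suc n" if "w \<in> Poly_Mapping.keys y" for w
    using that Suc.prems(1) by (cases w rule: rev_cases) (auto simp: in_keys_iff subset_iff)
  then have "length w \<le> n" if "w \<in> Poly_Mapping.keys y" for w
    using that Suc.prems(2)[OF that] by (metis le_SucE)
  then show ?case using Suc by blast
qed

lemma WF_kernel:
  assumes "Poly_Mapping.keys y \<subseteq> lists B" "WF y = 0"
  shows "y = 0"
  using assms WF_kernel_bounded[of y "Max (length ` Poly_Mapping.keys y)"] by simp

text \<open>Independence alone yields a left inverse of \<open>WF\<close>; the condition on its
  range keeps its values on words over \<open>B\<close>. That it is a right inverse too is proved
  afterwards, with its help.\<close>

lemma ex_coordinates: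
  "\<exists>G. qlinear G \<and> (\<forall>x. Poly_Mapping.keys (G x) \<subseteq> lists B) \<and>
     (\<forall>y. Poly_Mapping.keys y \<subseteq> lists B \<longrightarrow> G (WF y) = y)"
proof -
  let ?V = "{y :: H list \<Rightarrow>\<^sub>0 rat. Poly_Mapping.keys y \<subseteq> lists B}"
  have V: "pm.subspace ?V"
  proof (rule pm.subspaceI)
    fix x y :: "H list \<Rightarrow>\<^sub>0 rat" and c
    show "x + y \<in> ?V" if "x \<in> ?V" "y \<in> ?V" using keys_add[of x y] that by auto
    have "Poly_Mapping.keys (sc c x) \<subseteq> Poly_Mapping.keys x" by (auto simp: in_keys_iff)
    then show "sc c x \<in> ?V" if "x \<in> ?V" using that by auto
  qed simp
  have "inj_on WF ?V"
  proof (rule inj_onI)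
    fix x y assume "x \<in> ?V" "y \<in> ?V" "WF x = WF y"
    moreover from this have "x - y \<in> ?V" by (intro pm.subspace_diff[OF V])
    ultimately show "x = y"
      using WF_kernel[of "x - y"] by (simp add: qlinear_diff[OF qlinear_WF])
  qed
  moreover have "Vector_Spaces.linear sc sc WF"
    using qlinear_WF by (simp only: qlinear_iff_linear)
  ultimately obtain G where G: "range G \<subseteq> ?V" "Vector_Spaces.linear sc sc G" "\<forall>v\<in>?V. G (WF v) = v"
    using pmp.linear_exists_left_inverse_on[of WF ?V] V by blast
  then have "qlinear G" by (simp only: qlinear_iff_linear)
  then show ?thesis using G by (intro exI[of _ G]) blast
qed

definition coords :: "H \<Rightarrow> H list \<Rightarrow>\<^sub>0 rat" where
  "coords = (SOME G. qlinear G \<and> (\<forall>x. Poly_Mapping.keys (G x) \<subseteq> lists B) \<and>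
     (\<forall>y. Poly_Mapping.keys y \<subseteq> lists B \<longrightarrow> G (WF y) = y))"

lemma qlinear_coords [qlin]: "qlinear coords"
  and keys_coords: "Poly_Mapping.keys (coords x) \<subseteq> lists B"
  and coords_WF: "Poly_Mapping.keys y \<subseteq> lists B \<Longrightarrow> coords (WF y) = y"
  using someI_ex[OF ex_coordinates] unfolding coords_def by auto

lemma coords_wF: "w \<in> lists B \<Longrightarrow> coords (wF w) = bas w"
  using coords_WF[of "bas w"] by simp

lemma coords_one: "coords 1 = bas []"
  using coords_wF[of "[]"] by simp

lemma tm_coords_Delta_wF:
  assumes "w \<in> lists B"
  shows "tm coords coords (Delta (wF w)) = dec (bas w)"
proof -
  have "take i w \<in> lists B" "drop i w \<in> lists B" for i
    using assms by (auto dest: in_set_takeD in_set_dropD)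
  then show ?thesis
    using Delta_wF[OF lists_B[OF assms]]
    by (simp add: qlinear_sum[OF qlinear_tm'] tm_tens qlin coords_wF dec_bas)
qed

text \<open>If the reduced coproduct \<open>D\<close> of \<open>x\<close> is a combination of tensors of words with
  coefficients \<open>z\<close>, coassociativity makes \<open>z (u, v)\<close> depend on the word \<open>u @ v\<close> only.  Hence
  \<open>D\<close> is also the reduced coproduct of a combination of words, which differs from \<open>x\<close> by
  a primitive element.\<close>
lemma WF_coords_bas: "WF (coords (bas F)) = bas F"
proof (induction "fweight F" arbitrary: F rule: less_induct)
  case less
  define R where "R = {x. WF (coords x) = x}"
  have R: "pm.subspace R"
    unfolding R_def pm.subspace_def
    by (auto simp: qlinear_0 qlinear_add qlinear_sc qlinear_WF qlinear_coords)
  have WF_R: "WF y \<in> R" if "Poly_Mapping.keys y \<subseteq> lists B" for y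
    using coords_WF[OF that] by (simp add: R_def)
  have "B \<subseteq> R"
    using WF_R[of "bas [b]" for b] by auto
  then have Prim_R: "Prim \<subseteq> R"
    using Prim_span pm.span_minimal[OF _ R] by blast
  show ?case
  proof (cases "F = {#}")
    case True
    then show ?thesis by (simp add: coords_one)
  next
    case False
    define x where "x = bas F"
    define D where "D = Delta x - tens x 1 - tens 1 x"
    have Dx: "Delta x = D + tens x 1 + tens 1 x" by (simp add: D_def)
    have x0: "coef x {#} = 0" using False by (simp add: x_def lookup_single)
    \<comment> \<open>The counit removes the terms with an empty leg, and the grading then leaves
      two legs of smaller weight.\<close>
    have keysD: "a \<noteq> {#} \<and> b \<noteq> {#} \<and> fweight a < fweight F \<and> fweight b < fweight F"
      if "(a, b) \<in> Poly_Mapping.keys D" for a b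
    proof -
      have D: "coef D (a, b) \<noteq> 0" using that by (simp add: in_keys_iff)
      then have "a \<noteq> {#}" "b \<noteq> {#}"
        using x0 by (auto simp: D_def lookup_minus coef_Delta_left coef_Delta_right lookup_one when_def split: if_splits)
      moreover from this have "coef (Delta x) (a, b) \<noteq> 0"
        using D by (simp add: D_def lookup_minus lookup_one)
      then have "fweight a + fweight b = fweight F"
        using keys_Delta_forest[of F] by (auto simp: x_def Delta_bas in_keys_iff)
      moreover have "fweight a \<noteq> 0" "fweight b \<noteq> 0" using calculation by simp_all
      ultimately show ?thesis by linarith
    qed
    define z where "z = tm coords coords D"
    \<comment> \<open>By the weight bound both legs are covered by the induction hypothesis and can
      be rewritten as combinations of words.\<close>
    have Dz: "tm WF WF z = D"
      unfolding z_def tm_comp[OF qlinear_WF qlinear_WF]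
    proof (rule qlinear_ext_on[where x = D and g = "\<lambda>x. x"])
      fix k assume "k \<in> Poly_Mapping.keys D"
      then show "tm (\<lambda>x. WF (coords x)) (\<lambda>x. WF (coords x)) (bas k) = bas k"
        using keysD less by (cases k) (auto simp: tm_bas)
    qed (intro qlin)+
    have keysz: "u \<noteq> [] \<and> v \<noteq> [] \<and> u \<in> lists B \<and> v \<in> lists B" if "(u, v) \<in> Poly_Mapping.keys z" for u v
    proof -
      have "(u, v) \<in> (\<Union>k\<in>Poly_Mapping.keys D. Poly_Mapping.keys (case k of (a, b) \<Rightarrow> tens (coords (bas a)) (coords (bas b))))"
        using that[unfolded z_def tm_def] by (rule subsetD[OF keys_lin])
      then obtain a b where ab: "(a, b) \<in> Poly_Mapping.keys D"
        "coef (coords (bas a)) u \<noteq> 0" "coef (coords (bas b)) v \<noteq> 0"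
        by (auto simp: in_keys_iff)
      have "coef (coords (bas c)) [] = 0" if "c \<noteq> {#}" "fweight c < fweight F" for c
      proof -
        have "coef (coords (bas c)) [] = coef (WF (coords (bas c))) {#}"
          using keys_coords lists_B_Prim by (intro coef_WF_empty[symmetric]) blast
        then show ?thesis using that less by (simp add: lookup_single)
      qed
      then show ?thesis
        using ab keysD[OF ab(1)] keys_coords by (auto simp: in_keys_iff subset_iff)
    qed
    define cD where "cD = (\<lambda>x. tm coords coords (Delta x))"
    have cD: "qlinear cD" unfolding cD_def by (intro qlin qlinear_compose[OF _ qlinear_Delta])
    have cD1: "cD 1 = bas ([], [])"
      using tm_coords_Delta_wF[of "[]"] by (simp add: cD_def dec_bas)
    have L: "tm cD coords D = tm dec (\<lambda>x. x) z"
      unfolding Dz[symmetric] tm_comp[OF cD qlinear_coords]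
    proof (rule qlinear_ext_on[where x = z])
      fix k assume "k \<in> Poly_Mapping.keys z"
      then show "tm (\<lambda>x. cD (WF x)) (\<lambda>x. coords (WF x)) (bas k) = tm dec (\<lambda>x. x) (bas k)"
        using keysz by (cases k) (auto simp: tm_bas cD_def tm_coords_Delta_wF coords_wF)
    qed (intro qlin)+
    have Rt: "tm coords cD D = tm (\<lambda>x. x) dec z"
      unfolding Dz[symmetric] tm_comp[OF qlinear_coords cD]
    proof (rule qlinear_ext_on[where x = z])
      fix k assume "k \<in> Poly_Mapping.keys z"
      then show "tm (\<lambda>x. coords (WF x)) (\<lambda>x. cD (WF x)) (bas k) = tm (\<lambda>x. x) dec (bas k)"
        using keysz by (cases k) (auto simp: tm_bas cD_def tm_coords_Delta_wF coords_wF)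
    qed (intro qlin)+
    have "assocr (tm cD coords (Delta x)) = tm coords (tm coords coords) (assocr (tm Delta (\<lambda>x. x) (Delta x)))"
      by (simp add: tm_assocr qlin tm_comp cD_def)
    also have "\<dots> = tm coords cD (Delta x)"
      unfolding coassoc by (simp add: tm_comp qlin cD_def)
    finally have co: "assocr (tm cD coords (Delta x)) = tm coords cD (Delta x)" .
    \<comment> \<open>The terms x \<otimes> 1 and 1 \<otimes> x put an empty word in at least one of
      the three places, so for nonempty \<open>u\<close>, \<open>v\<close>, \<open>w\<close> only
      \<open>D\<close> contributes.\<close>
    have zz: "coef z (u @ v, w) = coef z (u, v @ w)" if "u \<noteq> []" "v \<noteq> []" "w \<noteq> []" for u v w
    proof -
      have "coef (tm cD coords (Delta x)) ((u, v), w) = coef z (u @ v, w)"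
        using that unfolding Dx
        by (simp add: qlinear_add[OF qlinear_tm'] lookup_add tm_tens cD qlin L lookup_tm_dec_left
            coords_one cD1 lookup_single)
      moreover have "coef (tm coords cD (Delta x)) (u, v, w) = coef z (u, v @ w)"
        using that unfolding Dx
        by (simp add: qlinear_add[OF qlinear_tm'] lookup_add tm_tens cD qlin Rt lookup_tm_dec_right
            coords_one cD1 lookup_single)
      ultimately show ?thesis
        using arg_cong[OF co, of "\<lambda>t. coef t (u, v, w)"] by (simp add: lookup_assocr)
    qed
    \<comment> \<open>Each word gets the coefficient of its split after the first letter. One-letter
      words get 0, as \<open>z\<close> has no empty legs; the primitive remainder accounts for
      them.\<close>
    define y where "y = lin (\<lambda>(u, v). if length u = 1 then bas (u @ v) else 0) z"
    have y0: "coef y [] = 0"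
      unfolding y_def lookup_lin by (intro sum.neutral) (auto simp: lookup_single split: if_splits)
    have y1: "coef y (b # v) = coef z ([b], v)" for b v
    proof -
      have "coef y (b # v) = (\<Sum>k\<in>Poly_Mapping.keys z. if k = ([b], v) then coef z k else 0)"
        unfolding y_def lookup_lin
        by (intro sum.cong) (auto simp: lookup_single when_def length_Suc_conv split: prod.splits)
      then show ?thesis by (simp add: sum.delta in_keys_iff)
    qed
    have yz: "coef y (u @ v) = coef z (u, v)" if uv: "u \<noteq> []" "v \<noteq> []" for u v
    proof -
      obtain b u' where u: "u = b # u'" using uv by (cases u) auto
      then show ?thesis
        using y1[of b "u' @ v"] zz[of "[b]" u' v] uv by (cases "u' = []") auto
    qed
    have z0: "coef z ([], v) = 0" "coef z (u, []) = 0" for u v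
      using keysz by (auto simp: in_keys_iff)
    have dy: "dec y = tens y (bas []) + tens (bas []) y + z"
    proof (rule poly_mapping_eqI)
      fix k :: "H list \<times> H list"
      obtain u v where k: "k = (u, v)" by (cases k)
      show "coef (dec y) k = coef (tens y (bas []) + tens (bas []) y + z) k"
        by (cases "u = []"; cases "v = []")
          (auto simp: k lookup_dec lookup_add lookup_single y0 z0 yz)
    qed
    have keysy: "Poly_Mapping.keys y \<subseteq> lists B"
    proof
      fix w assume w: "w \<in> Poly_Mapping.keys y"
      then obtain b v where "w = b # v" using y0 by (cases w) (auto simp: in_keys_iff)
      then show "w \<in> lists B" using w y1[of b v] keysz[of "[b]" v] by (auto simp: in_keys_iff)
    qed
    have "Delta (WF y) = tens (WF y) 1 + tens 1 (WF y) + D"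
      using Delta_WF[of y] keysy lists_B_Prim
      by (simp add: dy qlinear_add[OF qlinear_tm'] tm_tens qlin Dz)
    then have "x - WF y \<in> Prim"
      by (simp add: mem_Prim_iff qlinear_diff[OF qlinear_Delta] Dx tens_linear_left tens_linear_right)
    then have "(x - WF y) + WF y \<in> R"
      using Prim_R WF_R[OF keysy] pm.subspace_add[OF R] by blast
    then show ?thesis by (simp add: R_def x_def)
  qed
qed

lemma WF_coords [simp]: "WF (coords x) = x"
  by (rule qlinear_ext[where x = x and g = "\<lambda>x. x"])
    (intro qlinear_compose[OF qlinear_WF qlinear_coords] qlin WF_coords_bas)+

end

subsection \<open>Segmentations of words\<close>

text \<open>A composition of n into k parts in the formula amounts to cutting a word of length n
  into k nonempty segments.\<close>

definition segs :: "'a list \<Rightarrow> 'a list list set" where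
  "segs w = {ws. concat ws = w \<and> [] \<notin> set ws}"

lemma length_le_length_concat: "[] \<notin> set ws \<Longrightarrow> length ws \<le> length (concat ws)"
proof (induction ws)
  case (Cons x ws)
  then show ?case by (cases x) auto
qed simp

lemma finite_segs: "finite (segs w)"
proof -
  have "segs w \<subseteq> {ws. set ws \<subseteq> {x. set x \<subseteq> set w \<and> length x \<le> length w} \<and> length ws \<le> length w}"
  proof
    fix ws assume "ws \<in> segs w"
    then have w: "w = concat ws" and ne: "[] \<notin> set ws" by (auto simp: segs_def)
    have "length x \<le> length (concat ws)" if "x \<in> set ws" for x
      using that by (induction ws) auto
    then show "ws \<in> {ws. set ws \<subseteq> {x. set x \<subseteq> set w \<and> length x \<le> length w} \<and> length ws \<le> length w}"
      using length_le_length_concat[OF ne] by (auto simp: w)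
  qed
  moreover have "finite {ws. set ws \<subseteq> {x. set x \<subseteq> set w \<and> length x \<le> length w} \<and> length ws \<le> length w}"
    by (intro finite_lists_length_le) simp
  ultimately show ?thesis by (rule finite_subset)
qed

lemma segs_Nil: "segs [] = {[]}"
proof -
  have "ws = []" if "ws \<in> segs []" for ws :: "'a list list"
    using that by (cases ws) (auto simp: segs_def)
  then show ?thesis by (auto simp: segs_def)
qed

lemma segs_length_1: "w \<noteq> [] \<Longrightarrow> ws \<in> segs w \<Longrightarrow> length ws = 1 \<longleftrightarrow> ws = [w]"
  by (auto simp: segs_def length_Suc_conv)

lemma segs_lists: "w \<in> lists A \<Longrightarrow> ws \<in> segs w \<Longrightarrow> s \<in> set ws \<Longrightarrow> s \<in> lists A \<and> s \<noteq> []"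
  by (auto simp: segs_def)

text \<open>A segmentation with a marked boundary is the same as a cut of the word together with
  segmentations of both halves. This makes the formula compatible with deconcatenation.\<close>

lemma sum_segs_split:
  "(\<Sum>ws\<in>segs w. \<Sum>j\<le>length ws. f (take j ws) (drop j ws))
   = (\<Sum>i\<le>length w. \<Sum>xs\<in>segs (take i w). \<Sum>ys\<in>segs (drop i w). f xs ys)"
  (is "?l = ?r")
proof -
  define P where "P = {(xs, ys). xs @ ys \<in> segs w}"
  have "?l = (\<Sum>(ws, j)\<in>Sigma (segs w) (\<lambda>ws. {..length ws}). f (take j ws) (drop j ws))"
    by (simp add: sum.Sigma finite_segs)
  also have "\<dots> = (\<Sum>(xs, ys)\<in>P. f xs ys)"
    by (rule sum.reindex_bij_witness[where i = "\<lambda>(xs, ys). (xs @ ys, length xs)"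
          and j = "\<lambda>(ws, j). (take j ws, drop j ws)"]) (auto simp: P_def)
  also have "\<dots> = (\<Sum>(i, xs, ys)\<in>Sigma {..length w} (\<lambda>i. segs (take i w) \<times> segs (drop i w)). f xs ys)"
    by (rule sum.reindex_bij_witness[where i = "\<lambda>(i, xs, ys). (xs, ys)"
          and j = "\<lambda>(xs, ys). (length (concat xs), xs, ys)"]) (auto simp: P_def segs_def)
  also have "\<dots> = ?r"
    by (simp add: sum.Sigma finite_segs)
  finally show ?thesis .
qed

primrec cut_list :: "nat list \<Rightarrow> 'a list \<Rightarrow> 'a list list" where
  "cut_list [] w = []"
| "cut_list (a # as) w = take a w # cut_list as (drop a w)"

lemma cut_list_map_length: "cut_list (map length ws) (concat ws) = ws"
  by (induction ws) auto

lemma map_length_cut_list: "sum_list as \<le> length w \<Longrightarrow> map length (cut_list as w) = as"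
  by (induction as arbitrary: w) auto

lemma concat_cut_list: "sum_list as = length w \<Longrightarrow> concat (cut_list as w) = w"
proof (induction as arbitrary: w)
  case (Cons a as)
  then have "concat (cut_list as (drop a w)) = drop a w" by (intro Cons.IH) simp
  then show ?case by simp
qed simp

text \<open>A composition is the list of segment lengths. For n = 0 the left side has no terms,
  whereas \<open>segs []\<close> has one element.\<close>

lemma sum_compositions:
  fixes w :: "'a list"
  assumes "length w = n" "n \<ge> 1"
  shows "(\<Sum>k\<in>{1..n}. \<Sum>as\<in>compositions n k. f (cut_list as w)) = (\<Sum>ws\<in>segs w. f ws)"
proof -
  have fin: "finite (compositions n k)" for k
  proof -
    have "compositions n k \<subseteq> {as. set as \<subseteq> {..n} \<and> length as = k}"
      by (auto simp: compositions_def dest: member_le_sum_list)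
    then show ?thesis by (rule finite_subset) (simp add: finite_lists_length_eq)
  qed
  have "(\<Sum>k\<in>{1..n}. \<Sum>as\<in>compositions n k. f (cut_list as w))
      = (\<Sum>(k, as)\<in>Sigma {1..n} (compositions n). f (cut_list as w))"
    by (simp add: sum.Sigma fin)
  also have "\<dots> = (\<Sum>ws\<in>segs w. f ws)"
  proof (rule sum.reindex_bij_witness[where i = "\<lambda>ws. (length ws, map length ws)"
          and j = "\<lambda>(k, as). cut_list as w"])
    fix p assume "p \<in> Sigma {1..n} (compositions n)"
    then obtain k as where p: "p = (k, as)" and as: "length as = k" "\<forall>a\<in>set as. 1 \<le> a" "sum_list as = n"
      by (auto simp: compositions_def)
    have ml: "map length (cut_list as w) = as" by (rule map_length_cut_list) (simp add: as assms)
    then have len: "length (cut_list as w) = k" using as(1) by (metis length_map)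
    show "(length (case p of (k, as) \<Rightarrow> cut_list as w), map length (case p of (k, as) \<Rightarrow> cut_list as w)) = p"
      by (simp add: p ml len)
    have "[] \<notin> set (cut_list as w)"
    proof
      assume "[] \<in> set (cut_list as w)"
      then have "0 \<in> set (map length (cut_list as w))" by force
      then show False using as(2) by (simp only: ml) auto
    qed
    then show "(case p of (k, as) \<Rightarrow> cut_list as w) \<in> segs w"
      using concat_cut_list[of as w] as assms by (simp add: p segs_def)
    show "f (case p of (k, as) \<Rightarrow> cut_list as w) = (case p of (k, as) \<Rightarrow> f (cut_list as w))"
      by (simp add: p)
  next
    fix ws assume "ws \<in> segs w"
    then have ws: "concat ws = w" "[] \<notin> set ws" by (auto simp: segs_def)
    show "(case (length ws, map length ws) of (k, as) \<Rightarrow> cut_list as w) = ws"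
      using cut_list_map_length[of ws] by (simp add: ws)
    have "length ws \<ge> 1" using ws assms by (cases ws) auto
    moreover have "length ws \<le> n" using length_le_length_concat[OF ws(2)] ws(1) assms by simp
    moreover have "sum_list (map length ws) = n" using assms ws(1) by (metis length_concat)
    moreover have "1 \<le> length x" if "x \<in> set ws" for x
      using that ws(2) by (metis One_nat_def Suc_leI length_greater_0_conv)
    ultimately show "(length ws, map length ws) \<in> Sigma {1..n} (compositions n)"
      by (auto simp: compositions_def)
  qed
  finally show ?thesis .
qed

subsection \<open>The maps attached to a family\<close>

lemma tmaps_eq_lin: "tmaps u as = lin (blocks u as)"
  by (rule ext) (simp add: tmaps_def lin_def)

text \<open>\<open>blocks\<close> cuts off the first \<open>a\<close> entries, which separates the
  two factors when \<open>x\<close> lives on lists of length \<open>a\<close>.\<close>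

lemma tmaps_tensT:
  assumes "qlinear (u a)" "Poly_Mapping.keys x \<subseteq> {l. length l = a}"
  shows "tmaps u (a # as) (tensT x y) = tensT (lift (u a x)) (tmaps u as y)"
  unfolding tmaps_eq_lin
proof (rule qlinear_ext_on[where x = x and f = "\<lambda>x. lin (blocks u (a # as)) (tensT x y)"])
  fix l assume "l \<in> Poly_Mapping.keys x"
  then have l: "length l = a" using assms by auto
  show "lin (blocks u (a # as)) (tensT (bas l) y) = tensT (lift (u a (bas l))) (lin (blocks u as) y)"
    by (rule qlinear_ext[where x = y], (intro qlin)+) (simp add: l)
qed (intro qlin qlinear_compose[OF qlinear_lift] assms(1))+

text \<open>A segment is contracted to a single letter, so that \<open>map (letter_map u) ws\<close>
  is again a word.\<close>

definition letter_map :: "(nat \<Rightarrow> T \<Rightarrow> H) \<Rightarrow> H list \<Rightarrow> H" where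
  "letter_map u s = u (length s) (ptens s)"

lemma tmaps_ptens:
  assumes "\<And>i. i \<ge> 1 \<Longrightarrow> qlinear (u i)" "\<forall>a\<in>set as. 1 \<le> a" "sum_list as = length w"
  shows "tmaps u as (ptens w) = ptens (map (letter_map u) (cut_list as w))"
  using assms(2,3)
proof (induction as arbitrary: w)
  case Nil
  then show ?case by (simp add: tmaps_eq_lin)
next
  case (Cons a as)
  have "ptens w = tensT (ptens (take a w)) (ptens (drop a w))"
    by (simp flip: ptens_append)
  moreover have len: "length (take a w) = a" using Cons.prems by simp
  ultimately have "tmaps u (a # as) (ptens w) = tensT (lift (u a (ptens (take a w)))) (tmaps u as (ptens (drop a w)))"
    using tmaps_tensT[of u a "ptens (take a w)" as "ptens (drop a w)"] keys_ptens[of "take a w"] assms(1) Cons.prems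
    by simp
  moreover have "tmaps u as (ptens (drop a w)) = ptens (map (letter_map u) (cut_list as (drop a w)))"
    using Cons by (intro Cons.IH) auto
  moreover have "letter_map u (take a w) = u a (ptens (take a w))" by (simp only: letter_map_def len)
  ultimately show ?case by simp
qed

lemma qlinear_mem_span:
  assumes "qlinear f" "x \<in> pm.span S" "\<And>s. s \<in> S \<Longrightarrow> f s \<in> pm.span Z"
  shows "f x \<in> pm.span Z"
  using assms(2)
  by (induction rule: pm.span_induct_alt)
    (auto simp: qlinear_0 qlinear_add qlinear_sc assms(1) intro!: pm.span_zero pm.span_add pm.span_scale assms(3))

lemma qspan_subset_span: "x \<in> qspan S \<Longrightarrow> x \<in> pm.span S"
  by (induction rule: qspan.induct)
    (auto intro: pm.span_zero pm.span_add pm.span_scale pm.span_base)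

lemma ptens_mem_Prim_tens:
  assumes "set w \<subseteq> Prim"
  shows "ptens w \<in> Prim_tens (length w)"
proof -
  have "sc 1 (ptens w) + 0 \<in> Prim_tens (length w)"
    unfolding Prim_tens_def by (rule qspan.add[OF _ qspan.zero]) (use assms in blast)
  then show ?thesis by simp
qed

text \<open>The right-hand side of the formula on a word. The empty word has one segmentation, the
  empty one, which builds in the value 1 at 1.\<close>

definition seg_sum :: "(H list \<Rightarrow> H) \<Rightarrow> H list \<Rightarrow> H" where
  "seg_sum v w = (\<Sum>ws\<in>segs w. wF (map v ws))"

lemma seg_sum_Nil [simp]: "seg_sum v [] = 1"
  by (simp add: seg_sum_def segs_Nil)

lemma sum_tmaps_ptens:
  assumes "\<And>i. i \<ge> 1 \<Longrightarrow> qlinear (u i)" "length w = n" "n \<ge> 1"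
  shows "(\<Sum>k\<in>{1..n}. \<Sum>as\<in>compositions n k. Fmap (tmaps u as (ptens w))) = seg_sum (letter_map u) w"
proof -
  have "(\<Sum>k\<in>{1..n}. \<Sum>as\<in>compositions n k. Fmap (tmaps u as (ptens w)))
      = (\<Sum>k\<in>{1..n}. \<Sum>as\<in>compositions n k. wF (map (letter_map u) (cut_list as w)))"
    using assms by (intro sum.cong refl) (simp add: compositions_def tmaps_ptens wF_def)
  then show ?thesis
    using sum_compositions[OF assms(2,3), of "\<lambda>ws. wF (map (letter_map u) ws)"] by (simp add: seg_sum_def)
qed

lemma Delta_seg_sum:
  assumes "\<And>s. s \<in> lists A \<Longrightarrow> s \<noteq> [] \<Longrightarrow> v s \<in> Prim" "w \<in> lists A"
  shows "Delta (seg_sum v w) = (\<Sum>i\<le>length w. tens (seg_sum v (take i w)) (seg_sum v (drop i w)))"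
proof -
  have "Delta (seg_sum v w) = (\<Sum>ws\<in>segs w. \<Sum>j\<le>length ws. tens (wF (map v (take j ws))) (wF (map v (drop j ws))))"
    unfolding seg_sum_def qlinear_sum[OF qlinear_Delta]
  proof (intro sum.cong refl)
    fix ws assume "ws \<in> segs w"
    then have "set (map v ws) \<subseteq> Prim"
      using segs_lists[OF assms(2)] assms(1) by fastforce
    then show "Delta (wF (map v ws)) = (\<Sum>j\<le>length ws. tens (wF (map v (take j ws))) (wF (map v (drop j ws))))"
      by (simp add: Delta_wF take_map drop_map)
  qed
  also have "\<dots> = (\<Sum>i\<le>length w. tens (seg_sum v (take i w)) (seg_sum v (drop i w)))"
    unfolding sum_segs_split[where f = "\<lambda>xs ys. tens (wF (map v xs)) (wF (map v ys))"]
    by (simp only: seg_sum_def tens_linear_left(5)) (simp only: tens_linear_right(5))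
  finally show ?thesis .
qed

lemma coef_seg_sum_empty:
  assumes "\<And>s. s \<in> lists A \<Longrightarrow> s \<noteq> [] \<Longrightarrow> v s \<in> Prim" "w \<in> lists A"
  shows "coef (seg_sum v w) {#} = (if w = [] then 1 else 0)"
proof (cases "w = []")
  case False
  have "coef (wF (map v ws)) {#} = 0" if "ws \<in> segs w" for ws
  proof -
    have "set (map v ws) \<subseteq> Prim" using segs_lists[OF assms(2) that] assms(1) by fastforce
    moreover have "ws \<noteq> []" using that False by (auto simp: segs_def)
    ultimately show ?thesis by (simp add: coef_wF_empty)
  qed
  then show ?thesis using False by (simp add: seg_sum_def lookup_sum)
qed simp

section \<open>Linear maps compared on words over the basis\<close>

context prim_basis
begin

lemma qlinear_ext_words:
  assumes "qlinear f" "qlinear g" "\<And>w. w \<in> lists B \<Longrightarrow> f (wF w) = g (wF w)"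
  shows "f x = g x"
proof -
  have "f (WF (coords x)) = g (WF (coords x))"
  proof (rule qlinear_ext_on[where x = "coords x" and f = "\<lambda>y. f (WF y)" and g = "\<lambda>y. g (WF y)"])
    show "f (WF (bas w)) = g (WF (bas w))" if "w \<in> Poly_Mapping.keys (coords x)" for w
      using that keys_coords[of x] assms(3)[of w] by auto
  qed (intro qlinear_compose[OF _ qlinear_WF] assms)+
  then show ?thesis by simp
qed

lemma ptens_mem_span:
  assumes "set ps \<subseteq> Prim"
  shows "ptens ps \<in> pm.span {ptens w |w. w \<in> lists B \<and> length w = length ps}"
  using assms
proof (induction ps)
  case Nil
  then show ?case by (intro pm.span_base) force
next
  case (Cons p ps)
  let ?Z = "{ptens w |w. w \<in> lists B \<and> length w = length (p # ps)}"
  have 1: "tensT (lift b) (ptens w) \<in> pm.span ?Z" if "b \<in> B" "w \<in> lists B" "length w = length ps" for b w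
    using that by (intro pm.span_base CollectI exI[of _ "b # w"]) simp
  have 2: "tensT (lift b) (ptens ps) \<in> pm.span ?Z" if "b \<in> B" for b
    using 1 that Cons by (intro qlinear_mem_span[where x = "ptens ps" and f = "tensT (lift b)"] qlin) auto
  have "p \<in> pm.span B" using Cons Prim_span by auto
  then have "tensT (lift p) (ptens ps) \<in> pm.span ?Z"
    by (rule qlinear_mem_span[where x = p and f = "\<lambda>p. tensT (lift p) (ptens ps)", rotated])
      (intro 2 qlin, assumption, intro qlin)
  then show ?case by simp
qed

lemma qlinear_ext_Prim_tens:
  assumes "qlinear f" "qlinear g" "x \<in> Prim_tens n"
    "\<And>w. w \<in> lists B \<Longrightarrow> length w = n \<Longrightarrow> f (ptens w) = g (ptens w)"
  shows "f x = g x"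
proof (rule qlinear_ext_span[OF assms(1,2)])
  show "x \<in> pm.span {ptens ps |ps. length ps = n \<and> set ps \<subseteq> Prim}"
    using assms(3) qspan_subset_span by (simp add: Prim_tens_def)
  fix s assume "s \<in> {ptens ps |ps. length ps = n \<and> set ps \<subseteq> Prim}"
  then obtain ps where ps: "s = ptens ps" "length ps = n" "set ps \<subseteq> Prim" by blast
  show "f s = g s"
    unfolding ps(1)
    by (rule qlinear_ext_span[OF assms(1,2) ptens_mem_span[OF ps(3)]]) (use ps(2) assms(4) in blast)
qed

definition seg_map :: "(H list \<Rightarrow> H) \<Rightarrow> H \<Rightarrow> H" where
  "seg_map v x = lin (seg_sum v) (coords x)"

lemma qlinear_seg_map [qlin]: "qlinear (seg_map v)"
  unfolding seg_map_def by (intro qlin qlinear_coords)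

lemma seg_map_wF: "w \<in> lists B \<Longrightarrow> seg_map v (wF w) = seg_sum v w"
  by (simp add: seg_map_def coords_wF)

text \<open>Words over \<open>B\<close> determine linear maps on H and on the tensor powers, so the
  formula need only be tested on them. This gives existence and uniqueness for the
  \<open>THE\<close> in \<open>Phi_of\<close>.\<close>

lemma is_Phi_of_iff:
  assumes "valid_family u"
  shows "is_Phi_of u \<Phi> \<longleftrightarrow> qlinear \<Phi> \<and> (\<forall>w\<in>lists B. \<Phi> (wF w) = seg_sum (letter_map u) w)"
proof
  have u: "\<And>i. i \<ge> 1 \<Longrightarrow> qlinear (u i)" using assms by (simp add: valid_family_def)
  {
    assume \<Phi>: "is_Phi_of u \<Phi>"
    have "\<Phi> (wF w) = seg_sum (letter_map u) w" if w: "w \<in> lists B" for w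
    proof (cases "w = []")
      case True
      then show ?thesis using \<Phi> by (simp add: is_Phi_of_def)
    next
      case False
      then have n: "length w \<ge> 1" by (simp add: Suc_leI)
      have "\<Phi> (Fmap (ptens w)) = (\<Sum>k\<in>{1..length w}. \<Sum>as\<in>compositions (length w) k. Fmap (tmaps u as (ptens w)))"
        using \<Phi> n ptens_mem_Prim_tens[OF lists_B[OF w]] by (simp add: is_Phi_of_def)
      then show ?thesis using sum_tmaps_ptens[OF u refl n] by (simp add: wF_def)
    qed
    then show "qlinear \<Phi> \<and> (\<forall>w\<in>lists B. \<Phi> (wF w) = seg_sum (letter_map u) w)"
      using \<Phi> by (simp add: is_Phi_of_def)
  next
    assume \<Phi>: "qlinear \<Phi> \<and> (\<forall>w\<in>lists B. \<Phi> (wF w) = seg_sum (letter_map u) w)"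
    have "\<Phi> (Fmap x) = (\<Sum>k\<in>{1..n}. \<Sum>as\<in>compositions n k. Fmap (tmaps u as x))"
      if n: "n \<ge> 1" and x: "x \<in> Prim_tens n" for n x
    proof (rule qlinear_ext_Prim_tens[OF _ _ x, where f = "\<lambda>x. \<Phi> (Fmap x)"])
      show "qlinear (\<lambda>x. \<Phi> (Fmap x))" using \<Phi> qlinear_compose qlinear_Fmap by blast
      show "qlinear (\<lambda>x. \<Sum>k\<in>{1..n}. \<Sum>as\<in>compositions n k. Fmap (tmaps u as x))"
        unfolding tmaps_eq_lin by (intro qlin qlinear_compose[OF qlinear_Fmap])
      fix w assume w: "w \<in> lists B" "length w = n"
      show "\<Phi> (Fmap (ptens w)) = (\<Sum>k\<in>{1..n}. \<Sum>as\<in>compositions n k. Fmap (tmaps u as (ptens w)))"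
        using sum_tmaps_ptens[OF u w(2) n] \<Phi> w by (simp add: wF_def)
    qed
    moreover have "\<Phi> 1 = 1" using \<Phi> by (metis lists.Nil seg_sum_Nil wF_Nil)
    ultimately show "is_Phi_of u \<Phi>" using \<Phi> by (simp add: is_Phi_of_def)
  }
qed

lemma Phi_of_eq:
  assumes "valid_family u"
  shows "Phi_of u = seg_map (letter_map u)"
  unfolding Phi_of_def
proof (rule the_equality)
  show "is_Phi_of u (seg_map (letter_map u))"
    by (simp add: is_Phi_of_iff[OF assms] qlinear_seg_map seg_map_wF)
  fix \<Phi> assume "is_Phi_of u \<Phi>"
  then have "qlinear \<Phi>" "\<And>w. w \<in> lists B \<Longrightarrow> \<Phi> (wF w) = seg_map (letter_map u) (wF w)"
    by (simp_all add: is_Phi_of_iff[OF assms] seg_map_wF)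
  then show "\<Phi> = seg_map (letter_map u)"
    by - (rule ext, rule qlinear_ext_words[OF _ qlinear_seg_map])
qed

lemma letter_map_Prim:
  assumes "valid_family u" "s \<in> lists B" "s \<noteq> []"
  shows "letter_map u s \<in> Prim"
proof -
  have "length s \<ge> 1" using assms by (simp add: Suc_leI)
  then show ?thesis
    using assms(1) ptens_mem_Prim_tens[OF lists_B[OF assms(2)]]
    by (simp add: valid_family_def letter_map_def)
qed

lemma lists_B_take_drop: "w \<in> lists B \<Longrightarrow> take i w \<in> lists B \<and> drop i w \<in> lists B"
  by (metis append_in_lists_conv append_take_drop_id)

lemma coalg_endo_seg_map:
  assumes v: "\<And>s. s \<in> lists B \<Longrightarrow> s \<noteq> [] \<Longrightarrow> v s \<in> Prim"
  shows "coalg_endo (seg_map v)"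
  unfolding coalg_endo_def
proof (intro conjI allI)
  show "qlinear (seg_map v)" by (rule qlinear_seg_map)
  fix x
  have "coef (seg_map v x) {#} = (\<Sum>w\<in>Poly_Mapping.keys (coords x). if w = [] then coef (coords x) w else 0)"
    unfolding seg_map_def lookup_lin
  proof (intro sum.cong refl)
    fix w assume "w \<in> Poly_Mapping.keys (coords x)"
    then have w: "w \<in> lists B" using keys_coords by blast
    show "coef (coords x) w * coef (seg_sum v w) {#} = (if w = [] then coef (coords x) w else 0)"
      using coef_seg_sum_empty[OF v w] by simp
  qed
  also have "\<dots> = coef (coords x) []" by (simp add: sum.delta in_keys_iff)
  also have "\<dots> = coef (WF (coords x)) {#}"
    using keys_coords[of x] lists_B_Prim by (intro coef_WF_empty[symmetric]) blast
  finally show "eps (seg_map v x) = eps x" by (simp add: eps_def)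
  show "Delta (seg_map v x) = tmap2 (seg_map v) (seg_map v) (Delta x)"
    unfolding tmap2_eq_tm
  proof (rule qlinear_ext_words[where x = x])
    fix w assume w: "w \<in> lists B"
    show "Delta (seg_map v (wF w)) = tm (seg_map v) (seg_map v) (Delta (wF w))"
      using lists_B_take_drop[OF w] Delta_seg_sum[OF v w]
      by (simp add: Delta_wF[OF lists_B[OF w]] qlinear_sum[OF qlinear_tm'] tm_tens qlin seg_map_wF w)
  qed (intro qlin qlinear_compose[OF qlinear_Delta] qlinear_compose[OF _ qlinear_Delta])+
qed

section \<open>The projection onto the primitive elements and the recovery of the family\<close>

definition prim_proj :: "H \<Rightarrow> H" where
  "prim_proj x = lin (\<lambda>w. if length w = 1 then hd w else 0) (coords x)"

lemma qlinear_prim_proj [qlin]: "qlinear prim_proj"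
  unfolding prim_proj_def by (intro qlin qlinear_coords)

lemma prim_proj_mem_Prim: "prim_proj x \<in> Prim"
  unfolding prim_proj_def lin_def
proof (rule pm.subspace_sum[OF subspace_Prim])
  fix w assume "w \<in> Poly_Mapping.keys (coords x)"
  then have w: "w \<in> lists B" using keys_coords by blast
  have "(if length w = 1 then hd w else 0) \<in> Prim"
  proof (cases "length w = 1")
    case True
    then obtain b where "w = [b]" by (auto simp: length_Suc_conv)
    then show ?thesis using w B_Prim by auto
  qed (use pm.subspace_0[OF subspace_Prim] in simp)
  then show "sc (coef (coords x) w) (if length w = 1 then hd w else 0) \<in> Prim"
    by (rule pm.subspace_scale[OF subspace_Prim])
qed

text \<open>Contracted segments are arbitrary primitive elements, hence words over
  \<open>Prim\<close> and not only over \<open>B\<close>; multilinearity reduces them to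
  \<open>B\<close> without changing the length.\<close>

lemma prim_proj_wF:
  assumes "set ps \<subseteq> Prim"
  shows "prim_proj (wF ps) = (if length ps = 1 then hd ps else 0)"
proof (cases "length ps = 1")
  case True
  then obtain p where p: "ps = [p]" by (auto simp: length_Suc_conv)
  then have "p \<in> pm.span B" using assms Prim_span by auto
  then have "prim_proj p = p"
  proof (rule qlinear_ext_span[rotated 2, where g = "\<lambda>x. x"])
    fix b assume "b \<in> B"
    then show "prim_proj b = b" using coords_wF[of "[b]"] by (simp add: prim_proj_def)
  qed (intro qlin)+
  then show ?thesis using p by simp
next
  case False
  have "prim_proj (Fmap (ptens ps)) = 0"
  proof (rule qlinear_ext_span[OF _ _ ptens_mem_span[OF assms], where f = "\<lambda>x. prim_proj (Fmap x)" and g = "\<lambda>x. 0"])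
    fix s assume "s \<in> {ptens w |w. w \<in> lists B \<and> length w = length ps}"
    then obtain w where "s = ptens w" "w \<in> lists B" "length w = length ps" by blast
    then show "prim_proj (Fmap s) = 0"
      using False coords_wF[of w] by (simp add: prim_proj_def wF_def)
  qed (intro qlin qlinear_compose[OF qlinear_prim_proj])+
  then show ?thesis using False by (simp add: wF_def)
qed

lemma prim_proj_Prim: "p \<in> Prim \<Longrightarrow> prim_proj p = p"
  using prim_proj_wF[of "[p]"] by simp

text \<open>A segmentation into two or more segments gives a word of the same number of letters,
  which the projection kills; only \<open>[w]\<close> survives.\<close>

lemma prim_proj_seg_sum:
  assumes v: "\<And>s. s \<in> lists B \<Longrightarrow> s \<noteq> [] \<Longrightarrow> v s \<in> Prim" and w: "w \<in> lists B" "w \<noteq> []"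
  shows "prim_proj (seg_sum v w) = v w"
proof -
  have "prim_proj (seg_sum v w) = (\<Sum>ws\<in>segs w. if ws = [w] then v w else 0)"
    unfolding seg_sum_def qlinear_sum[OF qlinear_prim_proj]
  proof (intro sum.cong refl)
    fix ws assume ws: "ws \<in> segs w"
    then have "set (map v ws) \<subseteq> Prim"
      using segs_lists[OF w(1)] v by fastforce
    then show "prim_proj (wF (map v ws)) = (if ws = [w] then v w else 0)"
      using segs_length_1[OF w(2) ws] by (auto simp: prim_proj_wF)
  qed
  moreover have "[w] \<in> segs w" using w by (simp add: segs_def)
  ultimately show ?thesis by (simp add: sum.delta finite_segs)
qed

lemma tm_coords_Delta: "tm coords coords (Delta x) = dec (coords x)"
  by (rule qlinear_ext_words[where x = x],
      (intro qlin qlinear_compose[OF _ qlinear_Delta] qlinear_compose[OF qlinear_dec])+)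
    (simp add: tm_coords_Delta_wF coords_wF)

text \<open>A coefficient of a nonempty word in a group-like element would make the coefficients
  of all its powers nonzero.\<close>
lemma group_like_eq_one:
  assumes "Delta g = tens g g" "coef g {#} = 1"
  shows "g = 1"
proof -
  define c where "c = coords g"
  have "dec c = tens c c"
    using tm_coords_Delta[of g] by (simp add: c_def assms tm_tens qlin)
  then have mult: "coef c (u @ v) = coef c u * coef c v" for u v
    using lookup_dec[of c u v] by simp
  have c0: "coef c [] = 1"
    using coef_WF_empty[of c] keys_coords[of g] lists_B_Prim assms(2) by (auto simp: c_def)
  have "coef c w = 0" if w: "w \<noteq> []" for w
  proof (rule ccontr)
    assume nz: "coef c w \<noteq> 0"
    have pow: "coef c (concat (replicate n w)) = coef c w ^ n" for n
      by (induction n) (simp_all add: c0 mult)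
    have "inj (\<lambda>n. concat (replicate n w))"
    proof (rule injI)
      fix m n assume "concat (replicate m w) = concat (replicate n w)"
      then have "length (concat (replicate m w)) = length (concat (replicate n w))" by simp
      then show "m = n" using w by (simp add: length_concat sum_list_replicate)
    qed
    then have "infinite (range (\<lambda>n. concat (replicate n w)))"
      using finite_imageD infinite_UNIV_nat by blast
    moreover have "range (\<lambda>n. concat (replicate n w)) \<subseteq> Poly_Mapping.keys c"
      using nz pow by (auto simp: in_keys_iff)
    ultimately show False using finite_subset finite_keys by blast
  qed
  then have "c = bas []"
    by (intro poly_mapping_eqI) (metis c0 lookup_single_eq lookup_single_not_eq)
  then show ?thesis using WF_coords[of g] by (simp add: c_def)
qed

text \<open>1 is group-like, and a coalgebra map preserves this property and the counit.\<close>

lemma coalg_endo_one: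
  assumes "coalg_endo \<Phi>"
  shows "\<Phi> 1 = 1"
proof (rule group_like_eq_one)
  have "qlinear \<Phi>" using assms by (simp add: coalg_endo_def)
  then show "Delta (\<Phi> 1) = tens (\<Phi> 1) (\<Phi> 1)"
    using assms by (simp add: coalg_endo_def tmap2_eq_tm Delta_one) (simp add: one_eq_tens tm_tens)
  show "coef (\<Phi> 1) {#} = 1"
    using assms by (simp add: coalg_endo_def eps_def)
qed

lemma coalg_endo_eqI:
  assumes \<Phi>: "coalg_endo \<Phi>" and \<Psi>: "coalg_endo \<Psi>"
    and eq: "\<And>w. w \<in> lists B \<Longrightarrow> w \<noteq> [] \<Longrightarrow> prim_proj (\<Phi> (wF w)) = prim_proj (\<Psi> (wF w))"
  shows "\<Phi> = \<Psi>"
proof -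
  \<comment> \<open>The two outer terms are split off: they alone contain the image of
    \<open>w\<close> itself, while the inner ones involve shorter words, where the endomorphisms
    agree by induction.\<close>
  have Delta_endo: "Delta (\<Xi> (wF w)) = tens (\<Xi> (wF w)) 1 + tens 1 (\<Xi> (wF w))
      + (\<Sum>i\<in>{1..<length w}. tens (\<Xi> (wF (take i w))) (\<Xi> (wF (drop i w))))"
    if \<Xi>: "coalg_endo \<Xi>" and w: "w \<in> lists B" "w \<noteq> []" for \<Xi> w
  proof -
    have "Delta (\<Xi> (wF w)) = (\<Sum>i\<le>length w. tens (\<Xi> (wF (take i w))) (\<Xi> (wF (drop i w))))"
      using \<Xi> Delta_wF[OF lists_B[OF w(1)]]
      by (simp add: coalg_endo_def tmap2_eq_tm qlinear_sum[OF qlinear_tm'] tm_tens)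
    also have "{..length w} = insert 0 (insert (length w) {1..<length w})"
      using w(2) by auto
    finally show ?thesis
      using w(2) coalg_endo_one[OF \<Xi>] by (simp add: add_ac)
  qed
  have "\<Phi> (wF w) = \<Psi> (wF w)" if "w \<in> lists B" for w
    using that
  proof (induction "length w" arbitrary: w rule: less_induct)
    case less
    show ?case
    proof (cases "w = []")
      case True
      then show ?thesis by (simp add: coalg_endo_one \<Phi> \<Psi>)
    next
      case False
      define d where "d = \<Phi> (wF w) - \<Psi> (wF w)"
      have "(\<Sum>i\<in>{1..<length w}. tens (\<Phi> (wF (take i w))) (\<Phi> (wF (drop i w))))
          = (\<Sum>i\<in>{1..<length w}. tens (\<Psi> (wF (take i w))) (\<Psi> (wF (drop i w))))"
      proof (intro sum.cong refl)
        fix i assume "i \<in> {1..<length w}"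
        then have "length (take i w) < length w" "length (drop i w) < length w" by auto
        then have "\<Phi> (wF (take i w)) = \<Psi> (wF (take i w))" "\<Phi> (wF (drop i w)) = \<Psi> (wF (drop i w))"
          using less.hyps lists_B_take_drop[OF less.prems] by blast+
        then show "tens (\<Phi> (wF (take i w))) (\<Phi> (wF (drop i w)))
            = tens (\<Psi> (wF (take i w))) (\<Psi> (wF (drop i w)))" by simp
      qed
      then have "d \<in> Prim"
        unfolding mem_Prim_iff d_def qlinear_diff[OF qlinear_Delta]
        by (simp add: Delta_endo \<Phi> \<Psi> less.prems False tens_linear_left tens_linear_right)
      moreover have "prim_proj d = 0"
        using eq[OF less.prems False] by (simp add: d_def qlinear_diff[OF qlinear_prim_proj])
      ultimately have "d = 0" using prim_proj_Prim by simp
      then show ?thesis by (simp add: d_def)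
    qed
  qed
  then show ?thesis
    using \<Phi> \<Psi> by - (rule ext, rule qlinear_ext_words, auto simp: coalg_endo_def)
qed

lemma prim_proj_Phi_of:
  assumes "valid_family u" "w \<in> lists B" "w \<noteq> []"
  shows "prim_proj (Phi_of u (wF w)) = u (length w) (ptens w)"
proof -
  have "prim_proj (Phi_of u (wF w)) = letter_map u w"
    unfolding Phi_of_eq[OF assms(1)] seg_map_wF[OF assms(2)]
    by (rule prim_proj_seg_sum[OF letter_map_Prim[OF assms(1)] assms(2,3)])
  then show ?thesis by (simp add: letter_map_def)
qed

lemma coalg_endo_Phi_of: "valid_family u \<Longrightarrow> coalg_endo (Phi_of u)"
  using coalg_endo_seg_map[OF letter_map_Prim] by (simp add: Phi_of_eq)

text \<open>One formula serves for every \<open>i\<close>, since the argument carries its own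
  length. Both endomorphisms then have the same projection on words.\<close>

lemma Phi_of_prim_proj:
  assumes "coalg_endo \<Phi>"
  defines "u \<equiv> \<lambda>i::nat. \<lambda>x. prim_proj (\<Phi> (Fmap x))"
  shows "valid_family u" "\<Phi> = Phi_of u"
proof -
  have "qlinear \<Phi>" using assms(1) by (simp add: coalg_endo_def)
  then have "qlinear (u i)" for i
    unfolding u_def by (intro qlinear_compose[OF qlinear_prim_proj] qlinear_compose[OF _ qlinear_Fmap])
  then show u: "valid_family u"
    by (simp add: valid_family_def u_def prim_proj_mem_Prim)
  show "\<Phi> = Phi_of u"
    using prim_proj_Phi_of[OF u]
    by (intro coalg_endo_eqI[OF assms(1) coalg_endo_Phi_of[OF u]]) (simp add: u_def wF_def)
qed

text \<open>Uniqueness: the family can be read off from its endomorphism. The equality is limited to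
  \<open>Prim_tens i\<close> because \<open>valid_family\<close> leaves the values elsewhere
  free.\<close>

lemma Phi_of_inj:
  assumes "valid_family v" "i \<ge> 1" "x \<in> Prim_tens i"
  shows "v i x = prim_proj (Phi_of v (Fmap x))"
proof (rule qlinear_ext_Prim_tens[OF _ _ assms(3), where f = "v i"])
  show "qlinear (v i)" using assms by (simp add: valid_family_def)
  show "qlinear (\<lambda>x. prim_proj (Phi_of v (Fmap x)))"
    unfolding Phi_of_eq[OF assms(1)]
    by (intro qlinear_compose[OF qlinear_prim_proj] qlinear_compose[OF qlinear_seg_map] qlinear_Fmap)
  fix w assume "w \<in> lists B" "length w = i"
  then show "v i (ptens w) = prim_proj (Phi_of v (Fmap (ptens w)))"
    using prim_proj_Phi_of[OF assms(1), of w] assms(2) by (cases "w = []") (auto simp: wF_def)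
qed

end

theorem theorem11p2:
  shows "(\<forall>u. valid_family u \<longrightarrow> coalg_endo (Phi_of u)) \<and>
         (\<forall>\<Phi>. coalg_endo \<Phi> \<longrightarrow>
            (\<exists>u. valid_family u \<and> \<Phi> = Phi_of u \<and>
               (\<forall>v. valid_family v \<and> \<Phi> = Phi_of v \<longrightarrow>
                    (\<forall>i\<ge>1. \<forall>x\<in>Prim_tens i. v i x = u i x))))"
proof -
  obtain B :: "H set" where "B \<subseteq> Prim" "pm.independent B" "Prim \<subseteq> pm.span B"
    using pm.maximal_independent_subset[of Prim] by metis
  then interpret prim_basis B by unfold_locales
  show ?thesis
  proof (intro conjI allI impI)
    fix \<Phi> assume \<Phi>: "coalg_endo \<Phi>"
    let ?u = "\<lambda>i::nat. \<lambda>x. prim_proj (\<Phi> (Fmap x))"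
    show "\<exists>u. valid_family u \<and> \<Phi> = Phi_of u \<and>
        (\<forall>v. valid_family v \<and> \<Phi> = Phi_of v \<longrightarrow> (\<forall>i\<ge>1. \<forall>x\<in>Prim_tens i. v i x = u i x))"
      by (rule exI[of _ ?u], intro conjI Phi_of_prim_proj[OF \<Phi>]) (simp add: Phi_of_inj)
  qed (rule coalg_endo_Phi_of)
qed

end
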